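(* Let $(M,\phi,\xi,\eta,g)$ be a nearly Sasakian manifold and let $h$ be the $(1,1)$-tensor field defined by $\nabla_X\xi=-\phi X+hX$. Then the eigenvalues of the operator $h^2$ are constant (on $M$).
   Context: All manifolds are smooth and connected; $\nabla$ is the Levi-Civita connection of $g$. An almost contact metric structure $(\phi,\xi,\eta,g)$ on $M^{2n+1}$ consists of a $(1,1)$-tensor field $\phi$, a vector field $\xi$, a $1$-form $\eta$ and a Riemannian metric $g$ with $\phi^2=-I+\eta\otimes\xi$, $\eta(\xi)=1$, $g(\phi X,\phi Y)=g(X,Y)-\eta(X)\eta(Y)$. It is nearly Sasakian if $(\nabla_X\phi)Y+(\nabla_Y\phi)X=2g(X,Y)\xi-\eta(X)Y-\eta(Y)X$ for all vector fields $X,Y$. The tensor $h$ is then skew-symmetric with respect to $g$, so $h^2$ is a symmetric operator. *)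

theory Defs
  imports "HOL-Analysis.Analysis" "HOL-Library.Function_Algebras"
begin

text \<open>
  With pointwise operations, both tangent vectors (real functionals on functions) and vector
  fields form real vector spaces.
\<close>

instantiation "fun" :: (type, real_vector) real_vector
begin

definition scaleR_fun :: "real \<Rightarrow> ('a \<Rightarrow> 'b) \<Rightarrow> 'a \<Rightarrow> 'b"
  where "scaleR_fun a f = (\<lambda>x. a *\<^sub>R f x)"

instance
  by standard (auto simp: scaleR_fun_def fun_eq_iff scaleR_add_right scaleR_add_left)

end


subsection \<open>Smooth manifolds\<close>

text \<open>
  These notions are meant for open \<open>S\<close>: requiring continuity of all iterated directional
  derivatives up to order \<open>k\<close> then gives the usual class \<open>C\<^sup>k\<close>.
\<close>

primrec Ck_on :: "nat \<Rightarrow> 'e::euclidean_space set \<Rightarrow> ('e \<Rightarrow> 'f::real_normed_vector) \<Rightarrow> bool" where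
  "Ck_on 0 S f \<longleftrightarrow> continuous_on S f"
| "Ck_on (Suc k) S f \<longleftrightarrow>
     (\<forall>x\<in>S. f differentiable (at x)) \<and> (\<forall>v. Ck_on k S (\<lambda>x. frechet_derivative f (at x) v))"

definition smooth_on :: "'e::euclidean_space set \<Rightarrow> ('e \<Rightarrow> 'f::real_normed_vector) \<Rightarrow> bool"
  where "smooth_on S f \<longleftrightarrow> (\<forall>k. Ck_on k S f)"

text \<open>
  The manifold is the whole type \<open>'a\<close>, with its topology; \<open>'e\<close> is the model space. A chart is a
  pair of a domain and a coordinate map, whose values outside the domain are irrelevant. The smooth
  structure is given by an atlas, which need not be maximal.
\<close>

type_synonym ('a, 'e) chart = "'a set \<times> ('a \<Rightarrow> 'e)"

definition smooth_atlas ::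
    "('a::{t2_space,second_countable_topology}, 'e::euclidean_space) chart set \<Rightarrow> bool"
  where "smooth_atlas A \<longleftrightarrow>
    (\<forall>(U, c)\<in>A. open U \<and> open (c ` U) \<and> (\<exists>c'. homeomorphism U (c ` U) c c')) \<and>
    (\<Union>(U, c)\<in>A. U) = UNIV \<and>
    (\<forall>(U, c)\<in>A. \<forall>(V, d)\<in>A. smooth_on (c ` (U \<inter> V)) (d \<circ> inv_into U c))"

definition smooth_functions ::
    "('a::{t2_space,second_countable_topology}, 'e::euclidean_space) chart set \<Rightarrow> ('a \<Rightarrow> real) set"
  where "smooth_functions A = {f. \<forall>(U, c)\<in>A. smooth_on (c ` U) (f \<circ> inv_into U c)}"


subsection \<open>Tangent vectors, vector fields and tensor fields\<close>

definition smooth_curve ::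
    "('a::{t2_space,second_countable_topology}, 'e::euclidean_space) chart set
      \<Rightarrow> real set \<Rightarrow> (real \<Rightarrow> 'a) \<Rightarrow> bool"
  where "smooth_curve A I \<gamma> \<longleftrightarrow>
    continuous_on I \<gamma> \<and> (\<forall>(U, c)\<in>A. smooth_on (I \<inter> \<gamma> -` U) (c \<circ> \<gamma>))"

text \<open>
  A tangent vector at \<open>p\<close> is the operator \<open>f \<mapsto> (f \<circ> \<gamma>)'(0)\<close> on smooth functions
  given by a smooth curve \<open>\<gamma>\<close> with \<open>\<gamma> 0 = p\<close>. Extending it by \<open>0\<close> to non-smooth functions
  makes equality of tangent vectors equality of HOL functions.
\<close>

type_synonym 'a tangent = "('a \<Rightarrow> real) \<Rightarrow> real"

definition velocity ::
    "('a::{t2_space,second_countable_topology}, 'e::euclidean_space) chart set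
      \<Rightarrow> (real \<Rightarrow> 'a) \<Rightarrow> 'a tangent"
  where "velocity A \<gamma> = (\<lambda>f. if f \<in> smooth_functions A then deriv (f \<circ> \<gamma>) 0 else 0)"

definition tangent_space ::
    "('a::{t2_space,second_countable_topology}, 'e::euclidean_space) chart set
      \<Rightarrow> 'a \<Rightarrow> 'a tangent set"
  where "tangent_space A p =
    {velocity A \<gamma> | \<gamma> e. e > 0 \<and> smooth_curve A {-e<..<e} \<gamma> \<and> \<gamma> 0 = p}"

type_synonym 'a vfield = "'a \<Rightarrow> 'a tangent"

definition act :: "'a vfield \<Rightarrow> ('a \<Rightarrow> real) \<Rightarrow> 'a \<Rightarrow> real"
  where "act X f = (\<lambda>p. X p f)"

definition vector_fields ::
    "('a::{t2_space,second_countable_topology}, 'e::euclidean_space) chart set \<Rightarrow> 'a vfield set"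
  where "vector_fields A =
    {X. (\<forall>p. X p \<in> tangent_space A p) \<and>
        (\<forall>f\<in>smooth_functions A. act X f \<in> smooth_functions A)}"

definition lie_bracket :: "'a vfield \<Rightarrow> 'a vfield \<Rightarrow> 'a vfield"
  where "lie_bracket X Y = (\<lambda>p f. X p (act Y f) - Y p (act X f))"

definition fmult :: "('a \<Rightarrow> real) \<Rightarrow> 'a vfield \<Rightarrow> 'a vfield"
  where "fmult f X = (\<lambda>p. f p *\<^sub>R X p)"

definition linear_on_set :: "'v::real_vector set \<Rightarrow> ('v \<Rightarrow> 'w::real_vector) \<Rightarrow> bool"
  where "linear_on_set V T \<longleftrightarrow>
    (\<forall>v\<in>V. \<forall>w\<in>V. T (v + w) = T v + T w) \<and> (\<forall>a. \<forall>v\<in>V. T (a *\<^sub>R v) = a *\<^sub>R T v)"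

text \<open>
  Tensor fields are given pointwise on the tangent spaces (their values elsewhere are irrelevant),
  and are smooth if they send smooth vector fields to smooth vector fields or functions.
\<close>

type_synonym 'a endo_field = "'a \<Rightarrow> 'a tangent \<Rightarrow> 'a tangent"

definition app :: "'a endo_field \<Rightarrow> 'a vfield \<Rightarrow> 'a vfield"
  where "app T X = (\<lambda>p. T p (X p))"

definition tensor_field_11 ::
    "('a::{t2_space,second_countable_topology}, 'e::euclidean_space) chart set
      \<Rightarrow> 'a endo_field \<Rightarrow> bool"
  where "tensor_field_11 A T \<longleftrightarrow>
    (\<forall>p. linear_on_set (tangent_space A p) (T p) \<and>
         T p ` tangent_space A p \<subseteq> tangent_space A p) \<and>
    (\<forall>X\<in>vector_fields A. app T X \<in> vector_fields A)"

definition one_form ::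
    "('a::{t2_space,second_countable_topology}, 'e::euclidean_space) chart set
      \<Rightarrow> ('a \<Rightarrow> 'a tangent \<Rightarrow> real) \<Rightarrow> bool"
  where "one_form A \<eta> \<longleftrightarrow>
    (\<forall>p. linear_on_set (tangent_space A p) (\<eta> p)) \<and>
    (\<forall>X\<in>vector_fields A. (\<lambda>p. \<eta> p (X p)) \<in> smooth_functions A)"


subsection \<open>Riemannian metrics and the Levi-Civita connection\<close>

definition riemannian_metric ::
    "('a::{t2_space,second_countable_topology}, 'e::euclidean_space) chart set
      \<Rightarrow> ('a \<Rightarrow> 'a tangent \<Rightarrow> 'a tangent \<Rightarrow> real) \<Rightarrow> bool"
  where "riemannian_metric A g \<longleftrightarrow>
    (\<forall>p. \<forall>v\<in>tangent_space A p.
        linear_on_set (tangent_space A p) (g p v) \<and>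
        (\<forall>w\<in>tangent_space A p. g p v w = g p w v) \<and>
        (v \<noteq> 0 \<longrightarrow> g p v v > 0)) \<and>
    (\<forall>X\<in>vector_fields A. \<forall>Y\<in>vector_fields A. (\<lambda>p. g p (X p) (Y p)) \<in> smooth_functions A)"

definition affine_connection ::
    "('a::{t2_space,second_countable_topology}, 'e::euclidean_space) chart set
      \<Rightarrow> ('a vfield \<Rightarrow> 'a vfield \<Rightarrow> 'a vfield) \<Rightarrow> bool"
  where "affine_connection A nabla \<longleftrightarrow>
    (\<forall>X\<in>vector_fields A. \<forall>Y\<in>vector_fields A. nabla X Y \<in> vector_fields A) \<and>
    (\<forall>X\<in>vector_fields A. \<forall>X'\<in>vector_fields A. \<forall>Y\<in>vector_fields A.
        nabla (X + X') Y = nabla X Y + nabla X' Y) \<and>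
    (\<forall>f\<in>smooth_functions A. \<forall>X\<in>vector_fields A. \<forall>Y\<in>vector_fields A.
        nabla (fmult f X) Y = fmult f (nabla X Y)) \<and>
    (\<forall>X\<in>vector_fields A. \<forall>Y\<in>vector_fields A. \<forall>Y'\<in>vector_fields A.
        nabla X (Y + Y') = nabla X Y + nabla X Y') \<and>
    (\<forall>f\<in>smooth_functions A. \<forall>X\<in>vector_fields A. \<forall>Y\<in>vector_fields A.
        nabla X (fmult f Y) = fmult (act X f) Y + fmult f (nabla X Y))"

definition levi_civita ::
    "('a::{t2_space,second_countable_topology}, 'e::euclidean_space) chart set
      \<Rightarrow> ('a \<Rightarrow> 'a tangent \<Rightarrow> 'a tangent \<Rightarrow> real)
      \<Rightarrow> ('a vfield \<Rightarrow> 'a vfield \<Rightarrow> 'a vfield) \<Rightarrow> bool"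
  where "levi_civita A g nabla \<longleftrightarrow>
    affine_connection A nabla \<and>
    (\<forall>X\<in>vector_fields A. \<forall>Y\<in>vector_fields A. nabla X Y - nabla Y X = lie_bracket X Y) \<and>
    (\<forall>X\<in>vector_fields A. \<forall>Y\<in>vector_fields A. \<forall>Z\<in>vector_fields A.
        act X (\<lambda>p. g p (Y p) (Z p)) =
          (\<lambda>p. g p (nabla X Y p) (Z p) + g p (Y p) (nabla X Z p)))"

definition cov_deriv ::
    "('a vfield \<Rightarrow> 'a vfield \<Rightarrow> 'a vfield) \<Rightarrow> 'a endo_field \<Rightarrow> 'a vfield \<Rightarrow> 'a vfield \<Rightarrow> 'a vfield"
  where "cov_deriv nabla T X Y = nabla X (app T Y) - app T (nabla X Y)"


subsection \<open>Nearly Sasakian structures\<close>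

definition almost_contact_metric ::
    "('a::{t2_space,second_countable_topology}, 'e::euclidean_space) chart set
      \<Rightarrow> 'a endo_field \<Rightarrow> 'a vfield \<Rightarrow> ('a \<Rightarrow> 'a tangent \<Rightarrow> real)
      \<Rightarrow> ('a \<Rightarrow> 'a tangent \<Rightarrow> 'a tangent \<Rightarrow> real) \<Rightarrow> bool"
  where "almost_contact_metric A \<phi> \<xi> \<eta> g \<longleftrightarrow>
    tensor_field_11 A \<phi> \<and> \<xi> \<in> vector_fields A \<and> one_form A \<eta> \<and> riemannian_metric A g \<and>
    (\<forall>p. \<forall>v\<in>tangent_space A p. \<phi> p (\<phi> p v) = - v + \<eta> p v *\<^sub>R \<xi> p) \<and>
    (\<forall>p. \<eta> p (\<xi> p) = 1) \<and>
    (\<forall>p. \<forall>v\<in>tangent_space A p. \<forall>w\<in>tangent_space A p.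
        g p (\<phi> p v) (\<phi> p w) = g p v w - \<eta> p v * \<eta> p w)"

definition nearly_sasakian ::
    "('a::{t2_space,second_countable_topology}, 'e::euclidean_space) chart set
      \<Rightarrow> ('a vfield \<Rightarrow> 'a vfield \<Rightarrow> 'a vfield)
      \<Rightarrow> 'a endo_field \<Rightarrow> 'a vfield \<Rightarrow> ('a \<Rightarrow> 'a tangent \<Rightarrow> real)
      \<Rightarrow> ('a \<Rightarrow> 'a tangent \<Rightarrow> 'a tangent \<Rightarrow> real) \<Rightarrow> bool"
  where "nearly_sasakian A nabla \<phi> \<xi> \<eta> g \<longleftrightarrow>
    almost_contact_metric A \<phi> \<xi> \<eta> g \<and> levi_civita A g nabla \<and>
    (\<forall>X\<in>vector_fields A. \<forall>Y\<in>vector_fields A.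
        cov_deriv nabla \<phi> X Y + cov_deriv nabla \<phi> Y X =
          fmult (\<lambda>p. 2 * g p (X p) (Y p)) \<xi> - fmult (\<lambda>p. \<eta> p (X p)) Y - fmult (\<lambda>p. \<eta> p (Y p)) X)"


subsection \<open>Eigenvalues of a field of endomorphisms\<close>

definition endo_comp :: "'a endo_field \<Rightarrow> 'a endo_field \<Rightarrow> 'a endo_field"
  where "endo_comp S T = (\<lambda>p. S p \<circ> T p)"

definition eigenspace ::
    "('a::{t2_space,second_countable_topology}, 'e::euclidean_space) chart set
      \<Rightarrow> 'a endo_field \<Rightarrow> 'a \<Rightarrow> real \<Rightarrow> 'a tangent set"
  where "eigenspace A T p \<mu> = {v \<in> tangent_space A p. T p v = \<mu> *\<^sub>R v}"

definition eigenvalues ::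
    "('a::{t2_space,second_countable_topology}, 'e::euclidean_space) chart set
      \<Rightarrow> 'a endo_field \<Rightarrow> 'a \<Rightarrow> real set"
  where "eigenvalues A T p = {\<mu>. \<exists>v\<in>eigenspace A T p \<mu>. v \<noteq> 0}"

end

theory Submission
  imports Defs "HOL-Computational_Algebra.Polynomial"
begin

text \<open>
  Put \<open>A X = \<nabla>\<^sub>X \<xi> = - \<phi> X + h X\<close> and \<open>T X Y Z = g ((\<nabla>\<^sub>X \<phi>) Y) Z - g X Y \<eta> Z + \<eta> Y g X Z\<close>. The nearly Sasakian
  condition says that \<open>T\<close> is a 3-form; inserting \<open>\<xi>\<close> shows that \<open>h\<close> is skew, kills \<open>\<xi>\<close> and anticommutes with
  \<open>\<phi>\<close>, so that \<open>\<xi>\<close> is Killing. The Lie derivative along \<open>\<xi>\<close> therefore commutes with \<open>\<nabla>\<close>; it maps \<open>\<phi>\<close> to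
  \<open>3 \<phi> h\<close>, and applied to the nearly Sasakian condition it shows that \<open>\<nabla>(\<phi> h)\<close> is totally skew as well.
  Together with \<open>dd\<eta> = 0\<close> this forces \<open>T (h X) Y Z = 0\<close> on horizontal vectors, hence \<open>\<nabla>h\<^sup>2\<close> has no horizontal
  part. Equivalently, \<open>h\<^sup>2\<close> is parallel for the metric connection
  \<open>D\<^sub>X Y = \<nabla>\<^sub>X Y + g (A X) Y \<xi> - \<eta> Y A X\<close>, and parallel transport for \<open>D\<close> along coordinate segments maps
  eigenspaces of \<open>h\<^sup>2\<close> injectively into eigenspaces for the same eigenvalue.
\<close>

text \<open>Eigenvalues cannot be followed by differentiating them: where multiplicities might
  change, eigenvalue branches and eigenvector fields need not be smooth. Comparing dimensions of
  eigenspaces avoids any such choice, and injections in both directions between nearby points give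
  local constancy. The Levi-Civita connection itself cannot serve for the transport:
  \<open>h \<xi> = 0\<close> while \<open>\<nabla>\<^sub>X \<xi> = A X\<close>, so
  \<open>(\<nabla>\<^sub>X h\<^sup>2) \<xi> = - h\<^sup>2 (A X)\<close>. The correction in
  \<open>D\<close> is skew in \<open>Y\<close> and cancels this term. The number 3 in
  \<open>3 \<phi> h\<close> is 1 + 2: one copy is \<open>\<nabla>\<^sub>\<xi> \<phi>\<close>, two
  come from the commutator of \<open>\<phi>\<close> with \<open>A\<close>. The right side of the
  nearly Sasakian identity involves only \<open>g\<close>, \<open>\<eta>\<close> and
  \<open>\<xi>\<close>, which the flow of \<open>\<xi>\<close> preserves; hence the symmetric part
  of \<open>\<nabla>(\<phi> h)\<close> must vanish. Closedness of \<open>d\<eta>\<close> enters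
  because \<open>2 g (A X) Y = d\<eta> (X, Y)\<close>: the cyclic sums of \<open>\<nabla>h\<close>
  and \<open>\<nabla>\<phi>\<close> agree, which ties the unknown \<open>\<nabla>h\<close> to
  \<open>T\<close>.\<close>

subsection \<open>Calculus of smooth maps\<close>

text \<open>Product and chain rules rely on this: each term of their derivative still contains an
  undifferentiated factor, which is needed one order lower.\<close>

lemma Ck_on_Suc_imp: "Ck_on (Suc k) S f \<Longrightarrow> Ck_on k S f"
proof (induction k arbitrary: f)
  case 0
  then show ?case
    by (auto intro!: continuous_at_imp_continuous_on differentiable_imp_continuous_within)
next
  case (Suc k)
  show ?case
    unfolding Ck_on.simps(2)[of k]
  proof (intro conjI allI)
    show "\<forall>x\<in>S. f differentiable (at x)"
      using Suc.prems by simp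
    fix v
    show "Ck_on k S (\<lambda>x. frechet_derivative f (at x) v)"
      by (rule Suc.IH) (use Suc.prems in simp)
  qed
qed

lemma Ck_on_subset: "Ck_on k S f \<Longrightarrow> T \<subseteq> S \<Longrightarrow> Ck_on k T f"
  by (induction k arbitrary: f) (auto intro: continuous_on_subset)

text \<open>\<open>frechet_derivative\<close> is a choice operator; functions that agree near
  \<open>x\<close> have the same set of derivatives there, so the same one is chosen, even if the
  set is empty.\<close>

lemma frechet_derivative_cong_open:
  assumes "open S" "x \<in> S" "\<And>y. y \<in> S \<Longrightarrow> f y = g y"
  shows "frechet_derivative f (at x) = frechet_derivative g (at x)"
proof -
  have "(f has_derivative D) (at x) \<longleftrightarrow> (g has_derivative D) (at x)" for D
    using assms has_derivative_transform_within_open[of f D x UNIV S g]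
      has_derivative_transform_within_open[of g D x UNIV S f] by auto
  then show ?thesis
    by (simp add: frechet_derivative_def)
qed

lemma Ck_on_cong:
  assumes "open S" "\<And>x. x \<in> S \<Longrightarrow> f x = g x"
  shows "Ck_on k S f \<longleftrightarrow> Ck_on k S g"
  using assms(2)
proof (induction k arbitrary: f g)
  case 0
  then show ?case by (simp cong: continuous_on_cong)
next
  case (Suc k)
  have "f differentiable (at x) \<longleftrightarrow> g differentiable (at x)" if "x \<in> S" for x
    using assms(1) Suc.prems that has_derivative_transform_within_open[of f _ x UNIV S g]
      has_derivative_transform_within_open[of g _ x UNIV S f] unfolding differentiable_def by metis
  moreover have "Ck_on k S (\<lambda>x. frechet_derivative f (at x) v) \<longleftrightarrow>
      Ck_on k S (\<lambda>x. frechet_derivative g (at x) v)" for v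
    by (rule Suc.IH) (simp add: frechet_derivative_cong_open[OF assms(1) _ Suc.prems])
  ultimately show ?case by simp
qed

lemma Ck_on_local:
  assumes "\<And>x. x \<in> S \<Longrightarrow> \<exists>T. open T \<and> x \<in> T \<and> Ck_on k T f"
  shows "Ck_on k S f"
  using assms
proof (induction k arbitrary: f)
  case 0
  have "isCont f x" if "x \<in> S" for x
    using 0[OF that] by (auto simp: continuous_on_eq_continuous_at)
  then show ?case
    by (simp add: continuous_at_imp_continuous_on)
next
  case (Suc k)
  have "f differentiable (at x)" if "x \<in> S" for x
    using Suc.prems[OF that] by auto
  moreover have "Ck_on k S (\<lambda>x. frechet_derivative f (at x) v)" for v
    by (rule Suc.IH) (use Suc.prems in fastforce)
  ultimately show ?case by simp
qed

lemma Ck_on_const: "Ck_on k S (\<lambda>x. c)"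
  by (induction k arbitrary: c) auto

lemma has_derivative_frechet: "f differentiable (at x) \<Longrightarrow>
    (f has_derivative frechet_derivative f (at x)) (at x)"
  by (simp add: frechet_derivative_works)

lemma Ck_on_SucI:
  assumes "open S" "\<And>x. x \<in> S \<Longrightarrow> (f has_derivative f' x) (at x)"
    and "\<And>v. Ck_on k S (\<lambda>x. f' x v)"
  shows "Ck_on (Suc k) S f"
proof -
  have "frechet_derivative f (at x) = f' x" if "x \<in> S" for x
    using frechet_derivative_at[OF assms(2)[OF that]] by simp
  then have "Ck_on k S (\<lambda>x. frechet_derivative f (at x) v) \<longleftrightarrow> Ck_on k S (\<lambda>x. f' x v)" for v
    by (intro Ck_on_cong assms) simp
  with assms show ?thesis by (auto simp: differentiable_def)
qed

lemma Ck_on_SucD: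
  assumes "Ck_on (Suc k) S f"
  shows "\<And>x. x \<in> S \<Longrightarrow> (f has_derivative frechet_derivative f (at x)) (at x)"
    and "\<And>v. Ck_on k S (\<lambda>x. frechet_derivative f (at x) v)"
  using assms by (auto simp: has_derivative_frechet)

lemma Ck_on_bounded_linear:
  assumes "bounded_linear L" "open S" "Ck_on k S f"
  shows "Ck_on k S (\<lambda>x. L (f x))"
  using assms(3)
proof (induction k arbitrary: f)
  case 0
  then show ?case using assms(1) by (simp add: bounded_linear.continuous_on)
next
  case (Suc k)
  show ?case
    by (rule Ck_on_SucI[OF assms(2) bounded_linear.has_derivative[OF assms(1) Ck_on_SucD(1)[OF Suc.prems]]])
       (auto intro: Suc.IH Ck_on_SucD(2)[OF Suc.prems] simp del: Ck_on.simps)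
qed

lemma Ck_on_add:
  assumes "open S" "Ck_on k S f" "Ck_on k S g"
  shows "Ck_on k S (\<lambda>x. f x + g x)"
  using assms(2,3)
proof (induction k arbitrary: f g)
  case 0
  then show ?case by (auto intro: continuous_intros)
next
  case (Suc k)
  show ?case
    by (rule Ck_on_SucI[OF assms(1) has_derivative_add[OF Ck_on_SucD(1)[OF Suc.prems(1)] Ck_on_SucD(1)[OF Suc.prems(2)]]])
       (assumption+, intro Suc.IH Ck_on_SucD(2)[OF Suc.prems(1)] Ck_on_SucD(2)[OF Suc.prems(2)])
qed

lemma Ck_on_bilinear:
  assumes "bounded_bilinear B" "open S" "Ck_on k S f" "Ck_on k S g"
  shows "Ck_on k S (\<lambda>x. B (f x) (g x))"
  using assms(3,4)
proof (induction k arbitrary: f g)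
  case 0
  then show ?case using assms(1) by (auto intro: bounded_bilinear.continuous_on)
next
  case (Suc k)
  note fg = Ck_on_Suc_imp[OF Suc.prems(1)] Ck_on_Suc_imp[OF Suc.prems(2)]
  show ?case
    by (rule Ck_on_SucI[OF assms(2) bounded_bilinear.FDERIV[OF assms(1) Ck_on_SucD(1)[OF Suc.prems(1)] Ck_on_SucD(1)[OF Suc.prems(2)]]])
       (assumption+, intro Ck_on_add assms(2) Suc.IH fg Ck_on_SucD(2)[OF Suc.prems(1)] Ck_on_SucD(2)[OF Suc.prems(2)])
qed

lemma Ck_on_sum:
  assumes "open S" "\<And>i. i \<in> I \<Longrightarrow> Ck_on k S (f i)"
  shows "Ck_on k S (\<lambda>x. \<Sum>i\<in>I. f i x)"
  using assms(2)
proof (induction I rule: infinite_finite_induct)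
  case (insert i I)
  then show ?case
    using Ck_on_add[OF assms(1), of k "f i" "\<lambda>x. \<Sum>i\<in>I. f i x"] by simp
qed (simp_all add: Ck_on_const)

lemma Ck_on_compose:
  fixes g :: "'e::euclidean_space \<Rightarrow> 'f::euclidean_space"
  assumes "open S" "open T" "g ` S \<subseteq> T" "Ck_on k S g" "Ck_on k T f"
  shows "Ck_on k S (\<lambda>x. f (g x))"
  using assms(4,5)
proof (induction k arbitrary: f)
  case 0
  then show ?case using continuous_on_compose2[of T f S g] assms(3) by simp
next
  case (Suc k)
  note g' = Ck_on_SucD[OF Suc.prems(1)] and f' = Ck_on_SucD[OF Suc.prems(2)]
  show ?case
  \<comment> \<open>In the chain rule both the operator and its argument vary with \<open>x\<close>.
    Expanding the argument in the basis leaves sums of products, and the induction hypothesis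
    applies to each factor.\<close>
  proof (rule Ck_on_SucI[OF assms(1), where f' = "\<lambda>x v. \<Sum>b\<in>Basis.
        (frechet_derivative g (at x) v \<bullet> b) *\<^sub>R frechet_derivative f (at (g x)) b"])
    fix x assume x: "x \<in> S"
    have fd: "(f has_derivative frechet_derivative f (at (g x))) (at (g x))"
      by (rule f'(1)) (use x assms(3) in auto)
    have comp: "((\<lambda>x. f (g x)) has_derivative (\<lambda>v. frechet_derivative f (at (g x)) (frechet_derivative g (at x) v))) (at x)"
      using diff_chain_at[OF g'(1)[OF x] fd] by (simp add: o_def)
    have *: "frechet_derivative f (at (g x)) w =
      (\<Sum>b\<in>Basis. (w \<bullet> b) *\<^sub>R frechet_derivative f (at (g x)) b)" for w :: 'f
      using linear_sum[OF has_derivative_linear[OF fd], of "\<lambda>b. (w \<bullet> b) *\<^sub>R b" Basis]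
      unfolding euclidean_representation linear_scale[OF has_derivative_linear[OF fd]] .
    show "((\<lambda>x. f (g x)) has_derivative (\<lambda>v. \<Sum>b\<in>Basis.
        (frechet_derivative g (at x) v \<bullet> b) *\<^sub>R frechet_derivative f (at (g x)) b)) (at x)"
      by (rule has_derivative_eq_rhs[OF comp ext[OF *]])
  next
    fix v
    show "Ck_on k S (\<lambda>x. \<Sum>b\<in>Basis. (frechet_derivative g (at x) v \<bullet> b) *\<^sub>R frechet_derivative f (at (g x)) b)"
    proof (intro Ck_on_sum assms(1) Ck_on_bilinear[OF bounded_bilinear_scaleR])
      fix b :: 'f
      show "Ck_on k S (\<lambda>x. frechet_derivative g (at x) v \<bullet> b)"
        by (rule Ck_on_bounded_linear[OF bounded_linear_inner_left assms(1) g'(2)])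
      show "Ck_on k S (\<lambda>x. frechet_derivative f (at (g x)) b)"
        by (rule Suc.IH[OF Ck_on_Suc_imp[OF Suc.prems(1)] f'(2)])
    qed
  qed
qed

lemma Ck_on_id:
  assumes "open S"
  shows "Ck_on k S (\<lambda>x. x)"
proof (cases k)
  case 0
  then show ?thesis by (simp add: continuous_on_id)
next
  case (Suc j)
  have "Ck_on (Suc j) S (\<lambda>x. x)"
    by (rule Ck_on_SucI[OF assms has_derivative_ident Ck_on_const])
  then show ?thesis unfolding Suc .
qed

lemma smooth_on_subset: "smooth_on S f \<Longrightarrow> T \<subseteq> S \<Longrightarrow> smooth_on T f"
  by (auto simp: smooth_on_def intro: Ck_on_subset)

lemma smooth_on_cong: "open S \<Longrightarrow> (\<And>x. x \<in> S \<Longrightarrow> f x = g x) \<Longrightarrow> smooth_on S f \<longleftrightarrow> smooth_on S g"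
  using Ck_on_cong[of S f g] by (simp add: smooth_on_def)

lemma smooth_on_local:
  assumes "\<And>x. x \<in> S \<Longrightarrow> \<exists>T. open T \<and> x \<in> T \<and> smooth_on T f"
  shows "smooth_on S f"
  unfolding smooth_on_def
proof
  fix k
  show "Ck_on k S f"
    by (rule Ck_on_local) (use assms in \<open>fastforce simp: smooth_on_def\<close>)
qed

lemma smooth_on_const: "smooth_on S (\<lambda>x. c)"
  by (simp add: smooth_on_def Ck_on_const)

lemma smooth_on_id: "open S \<Longrightarrow> smooth_on S (\<lambda>x. x)"
  by (simp add: smooth_on_def Ck_on_id)

lemma smooth_on_bounded_linear:
  "bounded_linear L \<Longrightarrow> open S \<Longrightarrow> smooth_on S f \<Longrightarrow> smooth_on S (\<lambda>x. L (f x))"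
  unfolding smooth_on_def by (rule allI, rule Ck_on_bounded_linear) auto

lemma smooth_on_add:
  "open S \<Longrightarrow> smooth_on S f \<Longrightarrow> smooth_on S g \<Longrightarrow> smooth_on S (\<lambda>x. f x + g x)"
  unfolding smooth_on_def by (rule allI, rule Ck_on_add) auto

lemma smooth_on_bilinear:
  "bounded_bilinear B \<Longrightarrow> open S \<Longrightarrow> smooth_on S f \<Longrightarrow> smooth_on S g \<Longrightarrow> smooth_on S (\<lambda>x. B (f x) (g x))"
  unfolding smooth_on_def by (rule allI, rule Ck_on_bilinear) auto

lemmas smooth_on_scaleR = smooth_on_bilinear[OF bounded_bilinear_scaleR]
  and smooth_on_mult = smooth_on_bilinear[OF bounded_bilinear_mult]
  and smooth_on_inner = smooth_on_bilinear[OF bounded_bilinear_inner]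

lemma smooth_on_minus: "open S \<Longrightarrow> smooth_on S f \<Longrightarrow> smooth_on S (\<lambda>x. - f x)"
  by (rule smooth_on_bounded_linear[OF bounded_linear_minus[OF bounded_linear_ident]])

lemma smooth_on_diff:
  "open S \<Longrightarrow> smooth_on S f \<Longrightarrow> smooth_on S g \<Longrightarrow> smooth_on S (\<lambda>x. f x - g x)"
  using smooth_on_add[of S f "\<lambda>x. - g x"] smooth_on_minus[of S g] by simp

lemma smooth_on_compose:
  fixes g :: "'e::euclidean_space \<Rightarrow> 'f::euclidean_space"
  shows "open S \<Longrightarrow> open T \<Longrightarrow> g ` S \<subseteq> T \<Longrightarrow> smooth_on S g \<Longrightarrow> smooth_on T f \<Longrightarrow> smooth_on S (\<lambda>x. f (g x))"
  unfolding smooth_on_def by (rule allI, rule Ck_on_compose[of S T]) auto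

lemma smooth_on_imp_continuous_on: "smooth_on S f \<Longrightarrow> continuous_on S f"
  unfolding smooth_on_def using Ck_on.simps(1)[of S f] by metis

lemma smooth_on_has_derivative:
  "smooth_on S f \<Longrightarrow> x \<in> S \<Longrightarrow> (f has_derivative frechet_derivative f (at x)) (at x)"
  unfolding smooth_on_def by (rule Ck_on_SucD(1)[of 0]) auto

lemma smooth_on_frechet_derivative:
  "smooth_on S f \<Longrightarrow> smooth_on S (\<lambda>x. frechet_derivative f (at x) v)"
  unfolding smooth_on_def by (rule allI, rule Ck_on_SucD(2)) (erule spec)

subsection \<open>Bump functions\<close>

text \<open>Allowing a polynomial in \<open>1 / t\<close> makes the class closed under
  differentiation, so that smoothness of the classical flat function, the case \<open>q = 1\<close>,
  is an induction over all \<open>q\<close> at once.\<close>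

definition flat_exp :: "real poly \<Rightarrow> real \<Rightarrow> real"
  where "flat_exp q t = (if t > 0 then poly q (1 / t) * exp (- (1 / t)) else 0)"

lemma poly_times_exp_tendsto_0: "((\<lambda>s. poly q s * exp (- s)) \<longlongrightarrow> 0) at_top" for q :: "real poly"
proof -
  have "((\<lambda>s. \<Sum>i\<le>degree q. coeff q i * (s ^ i / exp s)) \<longlongrightarrow> (\<Sum>i\<le>degree q. coeff q i * 0)) at_top"
    by (intro tendsto_intros tendsto_power_div_exp_0)
  moreover have "(\<lambda>s. \<Sum>i\<le>degree q. coeff q i * (s ^ i / exp s)) = (\<lambda>s. poly q s * exp (- s))"
    by (auto simp: fun_eq_iff poly_altdef exp_minus sum_distrib_right divide_inverse mult.assoc)
  ultimately show ?thesis by simp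
qed

text \<open>With \<open>s = 1 / t\<close> one has \<open>d/dt = - s\<^sup>2 d/ds\<close>, hence the
  factor \<open>[:0, 0, 1:]\<close> and the polynomial \<open>q - pderiv q\<close>.\<close>

lemma flat_exp_deriv:
  "(flat_exp q has_real_derivative flat_exp ([:0, 0, 1:] * (q - pderiv q)) t) (at t)"
proof -
  consider "t > 0" | "t < 0" | "t = 0" by linarith
  then show ?thesis
  proof cases
    case 1
    have "((\<lambda>t. poly q (1 / t) * exp (- (1 / t))) has_real_derivative
        flat_exp ([:0, 0, 1:] * (q - pderiv q)) t) (at t)"
      using 1 by (auto intro!: derivative_eq_intros DERIV_chain2[OF poly_DERIV]
          simp: flat_exp_def field_simps power2_eq_square)
    then show ?thesis
      by (rule has_field_derivative_transform_within_open[of _ _ _ "{0<..}"])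
         (use 1 in \<open>auto simp: flat_exp_def\<close>)
  next
    case 2
    have "((\<lambda>t. 0) has_real_derivative flat_exp ([:0, 0, 1:] * (q - pderiv q)) t) (at t)"
      using 2 by (simp add: flat_exp_def)
    then show ?thesis
      by (rule has_field_derivative_transform_within_open[of _ _ _ "{..<0}"])
         (use 2 in \<open>auto simp: flat_exp_def\<close>)
  next
    case 3
    have r: "((\<lambda>h. flat_exp q h / h) \<longlongrightarrow> 0) (at_right 0)"
    proof -
      \<comment> \<open>Dividing by \<open>h\<close> is one more factor \<open>1 / h\<close>, which
        is absorbed into the polynomial.\<close>
      have "((\<lambda>h. poly ([:0, 1:] * q) (inverse h) * exp (- inverse h)) \<longlongrightarrow> 0) (at_right (0::real))"
        by (rule filterlim_compose[OF poly_times_exp_tendsto_0 filterlim_inverse_at_top_right])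
      then show ?thesis
        by (rule Lim_transform_eventually)
           (auto simp: flat_exp_def eventually_at_right_field divide_inverse algebra_simps intro!: exI[of _ 1])
    qed
    have l: "((\<lambda>h. flat_exp q h / h) \<longlongrightarrow> 0) (at_left 0)"
      by (rule Lim_transform_eventually[OF tendsto_const])
         (auto simp: flat_exp_def eventually_at_left_field intro!: exI[of _ "-1"])
    from l r have "((\<lambda>h. flat_exp q h / h) \<longlongrightarrow> 0) (at 0)"
      by (rule filterlim_split_at)
    then show ?thesis
      using 3 by (simp add: DERIV_def flat_exp_def)
  qed
qed

lemma Ck_on_flat_exp: "Ck_on k UNIV (flat_exp q)"
proof (induction k arbitrary: q)
  case 0
  then show ?case
    using flat_exp_deriv by (auto intro!: continuous_at_imp_continuous_on DERIV_isCont)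
next
  case (Suc k)
  show ?case
    by (rule Ck_on_SucI[OF open_UNIV flat_exp_deriv[unfolded has_field_derivative_def]])
       (intro Ck_on_bilinear[OF bounded_bilinear_mult] open_UNIV Suc Ck_on_const)
qed

lemma smooth_on_flat_exp: "smooth_on UNIV (flat_exp q)"
  by (simp add: smooth_on_def Ck_on_flat_exp)

text \<open>Nesting two copies of \<open>exp (- 1 / t)\<close> yields a plateau without dividing by a function.\<close>

lemma smooth_bump_exists:
  fixes x0 :: "'e::euclidean_space"
  assumes "r > 0"
  obtains b :: "'e \<Rightarrow> real" where "smooth_on UNIV b" "\<And>x. x \<in> ball x0 r \<Longrightarrow> b x = 1"
    "\<And>x. x \<notin> cball x0 (2 * r) \<Longrightarrow> b x = 0"
proof -
  define F where "F = flat_exp 1"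
  have F0: "F t = 0" if "t \<le> 0" for t using that by (simp add: F_def flat_exp_def)
  have Fpos: "F t > 0" if "t > 0" for t using that by (simp add: F_def flat_exp_def)
  have F1: "F t \<ge> exp (- 1)" if "t \<ge> 1" for t using that by (simp add: F_def flat_exp_def)
  have F: "smooth_on UNIV (\<lambda>x. F (u x))" if "smooth_on UNIV u" for u :: "'e \<Rightarrow> real"
    unfolding F_def by (rule smooth_on_compose[OF _ _ _ that smooth_on_flat_exp]) auto
  \<comment> \<open>\<open>u\<close> is at most 0 on the inner ball, where the inner
    \<open>F\<close> vanishes, and at least 1 outside the doubled ball, where the inner
    \<open>F\<close> is at least \<open>exp (- 1)\<close> and the outer argument is no longer
    positive.\<close>
  define u where "u x = 1 - (2 - ((x - x0) \<bullet> (x - x0)) / r\<^sup>2)" for x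
  define b where "b x = F (exp (- 1) - F (u x)) / F (exp (- 1))" for x
  have "smooth_on UNIV (\<lambda>x. 1 - (2 - ((x - x0) \<bullet> (x - x0)) * inverse (r\<^sup>2)))"
    by (intro smooth_on_diff smooth_on_mult smooth_on_inner smooth_on_const smooth_on_id open_UNIV)
  then have "smooth_on UNIV u" by (simp add: u_def[abs_def] divide_inverse)
  then have "smooth_on UNIV (\<lambda>x. F (exp (- 1) - F (u x)) * inverse (F (exp (- 1))))"
    by (intro smooth_on_mult F smooth_on_diff smooth_on_const open_UNIV)
  then have "smooth_on UNIV b" by (simp add: b_def[abs_def] divide_inverse)
  moreover have "b x = 1" if "x \<in> ball x0 r" for x
  proof -
    have "norm (x - x0) < r" using that by (simp add: dist_norm norm_minus_commute)
    then have "(norm (x - x0))\<^sup>2 \<le> r\<^sup>2" by (intro power_mono) auto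
    then have "u x \<le> 0" using assms by (simp add: u_def power2_norm_eq_inner)
    then show ?thesis using Fpos[of "exp (- 1)"] by (simp add: b_def F0)
  qed
  moreover have "b x = 0" if "x \<notin> cball x0 (2 * r)" for x
  proof -
    have "norm (x - x0) \<ge> 2 * r" using that by (simp add: dist_norm norm_minus_commute)
    then have "(2 * r)\<^sup>2 \<le> (norm (x - x0))\<^sup>2" using assms by (intro power_mono) auto
    then have "4 * r\<^sup>2 \<le> (x - x0) \<bullet> (x - x0)" by (simp add: power2_norm_eq_inner)
    then have "4 \<le> (x - x0) \<bullet> (x - x0) / r\<^sup>2" using assms by (simp add: field_simps)
    then have "u x \<ge> 1" by (simp add: u_def)
    then show ?thesis using F1[of "u x"] by (simp add: b_def F0)
  qed
  ultimately show ?thesis by (rule that)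
qed

subsection \<open>Smooth functions and charts\<close>

locale atlas =
  fixes A :: "('a::{t2_space,second_countable_topology}, 'e::euclidean_space) chart set"
  assumes atlas: "smooth_atlas A"
begin

abbreviation "SF \<equiv> smooth_functions A"
abbreviation "VF \<equiv> vector_fields A"
abbreviation "TS \<equiv> tangent_space A"

lemma chart_cover: obtains U c where "(U, c) \<in> A" "p \<in> U"
  using atlas unfolding smooth_atlas_def by blast

context
  fixes U c assumes chart: "(U, c) \<in> A"
begin

lemma chart_open: "open U" and chart_open_image: "open (c ` U)"
  using atlas chart unfolding smooth_atlas_def by blast+

lemma chart_homeomorphism: "homeomorphism U (c ` U) c (inv_into U c)"
proof -
  obtain c' where c': "homeomorphism U (c ` U) c c'"
    using atlas chart unfolding smooth_atlas_def by blast
  show ?thesis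
  proof (rule homeomorphism_cong[OF c'])
    fix y assume y: "y \<in> c ` U"
    have "inj_on c U" using c' by (metis homeomorphism_apply1 inj_onI)
    then show "inv_into U c y = c' y"
      using y c' by (auto simp: homeomorphism_apply1)
  qed auto
qed

lemma chart_inv [simp]: "p \<in> U \<Longrightarrow> inv_into U c (c p) = p"
  using chart_homeomorphism by (rule homeomorphism_apply1)

lemma chart_continuous: "continuous_on U c"
  and chart_inv_continuous: "continuous_on (c ` U) (inv_into U c)"
  using chart_homeomorphism by (auto simp: homeomorphism_def)

lemma chart_image_open: "open W \<Longrightarrow> open (c ` (U \<inter> W))"
proof -
  assume W: "open W"
  have "c ` (U \<inter> W) = inv_into U c -` W \<inter> c ` U"
    using chart_inv by (auto simp: image_iff)
  with W show ?thesis
    using continuous_on_open_vimage[OF chart_open_image, of "inv_into U c"] chart_inv_continuous by simp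
qed

lemma smooth_on_chart: "f \<in> SF \<Longrightarrow> smooth_on (c ` U) (f \<circ> inv_into U c)"
  using chart by (auto simp: smooth_functions_def)

end

lemma transition_smooth:
  "(U, c) \<in> A \<Longrightarrow> (W, d) \<in> A \<Longrightarrow> smooth_on (c ` (U \<inter> W)) (d \<circ> inv_into U c)"
  using atlas unfolding smooth_atlas_def by blast

text \<open>One chart around each point suffices: on an overlap, any other coordinate expression is
  this one composed with a smooth transition map.\<close>

lemma smooth_functionsI_local:
  assumes "\<And>p. \<exists>U c V. (U, c) \<in> A \<and> p \<in> U \<and> open V \<and> c p \<in> V \<and> V \<subseteq> c ` U \<and>
    smooth_on V (f \<circ> inv_into U c)"
  shows "f \<in> SF"
  unfolding smooth_functions_def
proof clarify
  fix W d assume Wd: "(W, d) \<in> A"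
  show "smooth_on (d ` W) (f \<circ> inv_into W d)"
  proof (rule smooth_on_local)
    fix y assume "y \<in> d ` W"
    then obtain p where p: "p \<in> W" "y = d p" by blast
    obtain U c V where UcV: "(U, c) \<in> A" "p \<in> U" "open V" "c p \<in> V" "V \<subseteq> c ` U"
      "smooth_on V (f \<circ> inv_into U c)"
      using assms[of p] by (elim exE conjE) (rule that)
    define T where "T = d ` (W \<inter> U) \<inter> (c \<circ> inv_into W d) -` V"
    have sm: "smooth_on (d ` (W \<inter> U)) (c \<circ> inv_into W d)"
      by (rule transition_smooth[OF Wd UcV(1)])
    have op: "open (d ` (W \<inter> U))"
      by (rule chart_image_open[OF Wd chart_open[OF UcV(1)]])
    have T: "open T"
      using continuous_on_open_vimage[OF op] smooth_on_imp_continuous_on[OF sm] UcV(3)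
      unfolding T_def by (metis Int_commute)
    have "smooth_on T (\<lambda>x. (f \<circ> inv_into U c) ((c \<circ> inv_into W d) x))"
      by (rule smooth_on_compose[OF T UcV(3) _ smooth_on_subset[OF sm] UcV(6)]) (auto simp: T_def)
    moreover have "(f \<circ> inv_into U c) ((c \<circ> inv_into W d) x) = (f \<circ> inv_into W d) x" if "x \<in> T" for x
      using that Wd UcV(1) by (auto simp: T_def)
    ultimately have "smooth_on T (f \<circ> inv_into W d)"
      using smooth_on_cong[OF T] by metis
    moreover have "y \<in> T" using p UcV Wd by (auto simp: T_def)
    ultimately show "\<exists>T. open T \<and> y \<in> T \<and> smooth_on T (f \<circ> inv_into W d)"
      using T by (intro exI[of _ T]) simp
  qed
qed

text \<open>The preimage of \<open>K\<close> is compact, hence closed because the manifold is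
  Hausdorff. A point outside the chart therefore has a neighbourhood on which the extension is
  0.\<close>

lemma smooth_functions_extend_zero:
  assumes Uc: "(U, c) \<in> A" and K: "compact K" "K \<subseteq> c ` U"
    and u: "smooth_on (c ` U) u" "\<And>x. x \<in> c ` U - K \<Longrightarrow> u x = 0"
  shows "(\<lambda>q. if q \<in> U then u (c q) else 0) \<in> SF"
proof (rule smooth_functionsI_local)
  fix p
  let ?F = "\<lambda>q. if q \<in> U then u (c q) else 0"
  show "\<exists>U c V. (U, c) \<in> A \<and> p \<in> U \<and> open V \<and> c p \<in> V \<and> V \<subseteq> c ` U \<and> smooth_on V (?F \<circ> inv_into U c)"
  proof (cases "p \<in> U")
    case True
    have "smooth_on (c ` U) (?F \<circ> inv_into U c)"
      by (subst smooth_on_cong[OF chart_open_image[OF Uc], of "?F \<circ> inv_into U c" u])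
         (use u(1) Uc in auto)
    then show ?thesis
      using True Uc chart_open_image[OF Uc] by (intro exI[of _ U] exI[of _ c] exI[of _ "c ` U"]) simp
  next
    case False
    define C where "C = inv_into U c ` K"
    have "closed C"
      unfolding C_def
      by (intro compact_imp_closed compact_continuous_image K
          continuous_on_subset[OF chart_inv_continuous[OF Uc]])
    have "C \<subseteq> U" using K(2) Uc by (auto simp: C_def)
    obtain W d where Wd: "(W, d) \<in> A" "p \<in> W" by (rule chart_cover)
    have op: "open (d ` (W \<inter> - C))"
      by (rule chart_image_open[OF Wd(1)]) (use \<open>closed C\<close> in auto)
    have "(?F \<circ> inv_into W d) y = 0" if y: "y \<in> d ` (W \<inter> - C)" for y
    proof -
      obtain q where q: "q \<in> W" "q \<notin> C" "y = d q" using y by blast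
      have "u (c q) = 0" if "q \<in> U"
      proof (rule u(2))
        have "c q \<notin> K" using q(2) that Uc by (force simp: C_def image_iff)
        with that show "c q \<in> c ` U - K" by blast
      qed
      then show ?thesis using q Wd(1) by simp
    qed
    then have "smooth_on (d ` (W \<inter> - C)) (?F \<circ> inv_into W d)"
      by (subst smooth_on_cong[OF op, of "?F \<circ> inv_into W d" "\<lambda>x. 0"]) (simp_all add: smooth_on_const)
    then show ?thesis
      using op Wd False \<open>C \<subseteq> U\<close> by (intro exI[of _ W] exI[of _ d] exI[of _ "d ` (W \<inter> - C)"]) auto
  qed
qed

lemma SF_const: "(\<lambda>p. k) \<in> SF"
  by (auto simp: smooth_functions_def o_def smooth_on_const)

lemma SF_0: "0 \<in> SF"
  using SF_const[of 0] by (simp add: zero_fun_def)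

lemma SF_add: "f \<in> SF \<Longrightarrow> g \<in> SF \<Longrightarrow> f + g \<in> SF"
  using chart_open_image by (force simp: smooth_functions_def o_def plus_fun_def intro!: smooth_on_add)

lemma SF_mult: "f \<in> SF \<Longrightarrow> g \<in> SF \<Longrightarrow> f * g \<in> SF"
  using chart_open_image by (force simp: smooth_functions_def o_def times_fun_def intro!: smooth_on_mult)

lemma SF_minus: "f \<in> SF \<Longrightarrow> - f \<in> SF"
  using chart_open_image by (force simp: smooth_functions_def o_def fun_Compl_def intro!: smooth_on_minus)

lemma SF_diff: "f \<in> SF \<Longrightarrow> g \<in> SF \<Longrightarrow> f - g \<in> SF"
  using SF_add[of f "- g"] SF_minus[of g] by simp

subsection \<open>Tangent vectors in coordinates\<close>

text \<open>The coordinate tangent vector with components \<open>v\<close>; the value 0 on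
  non-smooth functions follows the convention of \<open>velocity\<close>, so that both can be equal
  as HOL functions.\<close>

definition cvec :: "'a set \<Rightarrow> ('a \<Rightarrow> 'e) \<Rightarrow> 'a \<Rightarrow> 'e \<Rightarrow> 'a tangent"
  where "cvec U c p v =
    (\<lambda>f. if f \<in> SF then frechet_derivative (f \<circ> inv_into U c) (at (c p)) v else 0)"

lemma chart_has_derivative:
  assumes "(U, c) \<in> A" "x \<in> c ` U" "f \<in> SF"
  shows "((f \<circ> inv_into U c) has_derivative (\<lambda>v. cvec U c (inv_into U c x) v f)) (at x)"
proof -
  have "c (inv_into U c x) = x" using assms by (simp add: f_inv_into_f)
  then show ?thesis
    using smooth_on_has_derivative[OF smooth_on_chart[OF assms(1,3)] assms(2)] assms(3)
    by (simp add: cvec_def)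
qed

lemma cvec_linear:
  assumes Uc: "(U, c) \<in> A" "p \<in> U"
  shows "linear (cvec U c p)"
proof -
  have *: "linear (\<lambda>v. cvec U c p v f)" if "f \<in> SF" for f
    using has_derivative_linear[OF chart_has_derivative[OF Uc(1) imageI[OF Uc(2)] that]] Uc by simp
  show ?thesis
  proof (rule linearI)
    fix v w k
    show "cvec U c p (v + w) = cvec U c p v + cvec U c p w"
      using linear_add[OF *] by (auto simp: fun_eq_iff plus_fun_def cvec_def)
    show "cvec U c p (k *\<^sub>R v) = k *\<^sub>R cvec U c p v"
      using linear_scale[OF *] by (auto simp: fun_eq_iff scaleR_fun_def cvec_def)
  qed
qed

lemma chart_line_has_derivative:
  assumes "(U, c) \<in> A" "x + t *\<^sub>R v \<in> c ` U" "f \<in> SF"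
  shows "((\<lambda>s. f (inv_into U c (x + s *\<^sub>R v))) has_real_derivative
    cvec U c (inv_into U c (x + t *\<^sub>R v)) v f) (at t)"
proof -
  let ?D = "\<lambda>w. cvec U c (inv_into U c (x + t *\<^sub>R v)) w f"
  have D: "((f \<circ> inv_into U c) has_derivative ?D) (at (x + t *\<^sub>R v))"
    by (rule chart_has_derivative[OF assms])
  have "((\<lambda>s. x + s *\<^sub>R v) has_derivative (\<lambda>s. s *\<^sub>R v)) (at t)"
    by (auto intro!: derivative_eq_intros)
  from diff_chain_at[OF this D]
  have "((\<lambda>s. f (inv_into U c (x + s *\<^sub>R v))) has_derivative (\<lambda>s. ?D (s *\<^sub>R v))) (at t)"
    by (simp add: o_def)
  then show ?thesis
    unfolding has_field_derivative_def
    by (rule has_derivative_eq_rhs)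
       (simp add: fun_eq_iff linear_scale[OF has_derivative_linear[OF D]])
qed

lemma velocity_in_range_cvec:
  assumes Uc: "(U, c) \<in> A" "p \<in> U" and \<gamma>: "e > 0" "smooth_curve A {-e<..<e} \<gamma>" "\<gamma> 0 = p"
  shows "velocity A \<gamma> \<in> range (cvec U c p)"
proof -
  define I where "I = {-e<..<e} \<inter> \<gamma> -` U"
  have cont: "continuous_on {-e<..<e} \<gamma>" and sm: "smooth_on I (c \<circ> \<gamma>)"
    using \<gamma>(2) Uc(1) by (auto simp: smooth_curve_def I_def)
  have I: "open I"
    using continuous_on_open_vimage[of "{-e<..<e}" \<gamma>] cont chart_open[OF Uc(1)]
    by (auto simp: I_def Int_commute)
  have 0: "0 \<in> I" using \<gamma> Uc by (simp add: I_def)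
  define D where "D = frechet_derivative (c \<circ> \<gamma>) (at 0)"
  have D: "((c \<circ> \<gamma>) has_derivative D) (at 0)"
    unfolding D_def by (rule smooth_on_has_derivative[OF sm 0])
  have "velocity A \<gamma> f = cvec U c p (D 1) f" for f
  proof (cases "f \<in> SF")
    case True
    let ?L = "\<lambda>v. cvec U c p v f"
    have L: "((f \<circ> inv_into U c) has_derivative ?L) (at ((c \<circ> \<gamma>) 0))"
      using chart_has_derivative[OF Uc(1) imageI[OF Uc(2)] True] Uc \<gamma>(3) by simp
    have "((f \<circ> inv_into U c) \<circ> (c \<circ> \<gamma>) has_derivative ?L \<circ> D) (at 0)"
      by (rule diff_chain_at[OF D L])
    then have "((f \<circ> \<gamma>) has_derivative ?L \<circ> D) (at 0)"
      by (rule has_derivative_transform_within_open[OF _ I 0]) (use Uc in \<open>auto simp: I_def\<close>)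
    then have "((f \<circ> \<gamma>) has_real_derivative ?L (D 1)) (at 0)"
      unfolding has_field_derivative_def
    proof (rule has_derivative_eq_rhs)
      have *: "?L (D s) = ?L (D 1) * s" for s
      proof -
        have "D s = s *\<^sub>R D 1"
          using linear_scale[OF has_derivative_linear[OF D], of s 1] by simp
        then have "?L (D s) = ?L (s *\<^sub>R D 1)"
          by (rule arg_cong)
        then show ?thesis
          using linear_scale[OF has_derivative_linear[OF L], of s "D 1"] by (simp add: mult.commute)
      qed
      show "?L \<circ> D = (*) (?L (D 1))"
        by (rule ext) (unfold comp_apply, rule *)
    qed
    then show ?thesis
      using True by (simp add: velocity_def DERIV_imp_deriv)
  qed (simp add: velocity_def cvec_def)
  then show ?thesis by auto
qed

text \<open>The witness is the straight coordinate line through \<open>c p\<close> in direction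
  \<open>v\<close>, on an interval short enough to stay in the chart.\<close>

lemma cvec_in_tangent_space:
  assumes Uc: "(U, c) \<in> A" "p \<in> U"
  shows "cvec U c p v \<in> TS p"
proof -
  define l where "l t = c p + t *\<^sub>R v" for t :: real
  have l: "smooth_on UNIV l"
    unfolding l_def[abs_def] by (intro smooth_on_add smooth_on_scaleR smooth_on_const smooth_on_id open_UNIV)
  have lc: "continuous_on UNIV l" by (rule smooth_on_imp_continuous_on[OF l])
  have "open (l -` (c ` U))"
    by (rule open_vimage[OF chart_open_image[OF Uc(1)] lc])
  moreover have "0 \<in> l -` (c ` U)" using Uc by (simp add: l_def)
  ultimately obtain e where e: "e > 0" "ball 0 e \<subseteq> l -` (c ` U)"
    by (meson openE)
  define \<gamma> where "\<gamma> t = inv_into U c (l t)" for t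
  have lU: "l t \<in> c ` U" if "t \<in> {-e<..<e}" for t
    using e(2) that by (auto simp: subset_iff dist_real_def)
  have "smooth_curve A {-e<..<e} \<gamma>"
    unfolding smooth_curve_def
  proof (intro conjI, safe)
    show cont: "continuous_on {-e<..<e} \<gamma>"
      unfolding \<gamma>_def
      by (rule continuous_on_compose2[OF chart_inv_continuous[OF Uc(1)] continuous_on_subset[OF lc]]) (use lU in auto)
    fix W d assume Wd: "(W, d) \<in> A"
    let ?I = "{-e<..<e} \<inter> \<gamma> -` W"
    have I: "open ?I"
      using continuous_on_open_vimage[of "{-e<..<e}" \<gamma>] cont chart_open[OF Wd] by (auto simp: Int_commute)
    have "l ` ?I \<subseteq> c ` (U \<inter> W)"
    proof safe
      fix t assume t: "t \<in> {-e<..<e}" "\<gamma> t \<in> W"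
      then obtain q where "q \<in> U" "l t = c q" using lU by blast
      then show "l t \<in> c ` (U \<inter> W)" using t Uc(1) by (auto simp: \<gamma>_def)
    qed
    then have "smooth_on ?I (\<lambda>t. (d \<circ> inv_into U c) (l t))"
      by (rule smooth_on_compose[OF I chart_image_open[OF Uc(1) chart_open[OF Wd]] _
            smooth_on_subset[OF l] transition_smooth[OF Uc(1) Wd]]) auto
    then show "smooth_on ?I (d \<circ> \<gamma>)" by (simp add: o_def \<gamma>_def)
  qed
  moreover have "\<gamma> 0 = p" using Uc by (simp add: \<gamma>_def l_def)
  moreover have "velocity A \<gamma> = cvec U c p v"
  proof
    fix f
    show "velocity A \<gamma> f = cvec U c p v f"
    proof (cases "f \<in> SF")
      case True
      have "((f \<circ> \<gamma>) has_real_derivative cvec U c p v f) (at 0)"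
        using chart_line_has_derivative[OF Uc(1) _ True, of "c p" 0 v] Uc by (simp add: \<gamma>_def[abs_def] l_def o_def)
      then show ?thesis using True by (simp add: velocity_def DERIV_imp_deriv)
    qed (simp add: velocity_def cvec_def)
  qed
  ultimately show ?thesis
    unfolding tangent_space_def using e(1) by (metis (mono_tags, lifting) mem_Collect_eq)
qed

lemma tangent_space_eq_range:
  assumes "(U, c) \<in> A" "p \<in> U"
  shows "TS p = range (cvec U c p)"
proof
  show "TS p \<subseteq> range (cvec U c p)"
    unfolding tangent_space_def using velocity_in_range_cvec[OF assms] by blast
  show "range (cvec U c p) \<subseteq> TS p" using cvec_in_tangent_space[OF assms] by blast
qed

lemma subspace_tangent_space: "subspace (TS p)"
proof -
  obtain U c where "(U, c) \<in> A" "p \<in> U" by (rule chart_cover)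
  then show ?thesis
    using linear_subspace_image[OF cvec_linear subspace_UNIV] tangent_space_eq_range by metis
qed

lemma tangent_rules:
  assumes "t \<in> TS p"
  shows tangent_add: "f \<in> SF \<Longrightarrow> g \<in> SF \<Longrightarrow> t (f + g) = t f + t g"
    and tangent_minus: "f \<in> SF \<Longrightarrow> t (- f) = - t f"
    and tangent_const: "t (\<lambda>q. k) = 0"
    and tangent_nonsmooth: "f \<notin> SF \<Longrightarrow> t f = 0"
proof -
  obtain U c where Uc: "(U, c) \<in> A" "p \<in> U" by (rule chart_cover)
  then obtain v where v: "t = cvec U c p v" using assms tangent_space_eq_range by blast
  have D: "((f \<circ> inv_into U c) has_derivative (\<lambda>v. cvec U c p v f)) (at (c p))" if "f \<in> SF" for f
    using chart_has_derivative[OF Uc(1) imageI[OF Uc(2)] that] Uc by simp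
  note uni = has_derivative_unique[THEN fun_cong]
  show "t (f + g) = t f + t g" if "f \<in> SF" "g \<in> SF"
    unfolding v by (rule uni[OF D[OF SF_add[OF that]]])
      (use has_derivative_add[OF D[OF that(1)] D[OF that(2)]] in \<open>simp add: o_def plus_fun_def\<close>)
  show "t (- f) = - t f" if "f \<in> SF"
    unfolding v by (rule uni[OF D[OF SF_minus[OF that]]])
      (use has_derivative_minus[OF D[OF that]] in \<open>simp add: o_def fun_Compl_def\<close>)
  show "t (\<lambda>q. k) = 0"
    unfolding v by (rule uni[OF D[OF SF_const]]) (simp add: o_def)
  show "t f = 0" if "f \<notin> SF"
    using that by (simp add: v cvec_def)
qed

subsection \<open>Vector fields\<close>

lemma VF_tangent: "X \<in> VF \<Longrightarrow> X p \<in> TS p"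
  and VF_act: "X \<in> VF \<Longrightarrow> f \<in> SF \<Longrightarrow> act X f \<in> SF"
  by (auto simp: vector_fields_def)

lemma VF_add:
  assumes "X \<in> VF" "Y \<in> VF"
  shows "X + Y \<in> VF"
  unfolding vector_fields_def
proof (intro CollectI conjI allI ballI)
  fix p show "(X + Y) p \<in> TS p"
    using subspace_add[OF subspace_tangent_space] VF_tangent assms by simp
next
  fix f assume "f \<in> SF"
  moreover have "act (X + Y) f = act X f + act Y f" by (simp add: act_def fun_eq_iff)
  ultimately show "act (X + Y) f \<in> SF" using SF_add VF_act assms by simp
qed

lemma VF_fmult:
  assumes "f \<in> SF" "X \<in> VF"
  shows "fmult f X \<in> VF"
  unfolding vector_fields_def
proof (intro CollectI conjI allI ballI)
  fix p show "fmult f X p \<in> TS p"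
    using subspace_scale[OF subspace_tangent_space] VF_tangent assms by (simp add: fmult_def)
next
  fix k assume "k \<in> SF"
  moreover have "act (fmult f X) k = f * act X k"
    by (simp add: act_def fun_eq_iff fmult_def scaleR_fun_def)
  ultimately show "act (fmult f X) k \<in> SF" using SF_mult VF_act assms by simp
qed

lemma VF_minus: "X \<in> VF \<Longrightarrow> - X \<in> VF"
proof -
  assume "X \<in> VF"
  then have "fmult (\<lambda>p. -1) X \<in> VF" by (intro VF_fmult SF_const)
  moreover have "fmult (\<lambda>p. -1) X = - X" by (simp add: fmult_def fun_eq_iff)
  ultimately show ?thesis by simp
qed

lemma VF_diff: "X \<in> VF \<Longrightarrow> Y \<in> VF \<Longrightarrow> X - Y \<in> VF"
  using VF_add[of X "- Y"] VF_minus[of Y] by simp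

lemma VF_0: "0 \<in> VF"
proof -
  have "act 0 f = (0 :: 'a \<Rightarrow> real)" for f by (simp add: act_def fun_eq_iff)
  then show ?thesis
    using SF_0 subspace_0[OF subspace_tangent_space] by (auto simp: vector_fields_def)
qed

text \<open>The connection accepts only globally defined fields, so coordinate fields and coordinate
  functions are multiplied by a bump function that is 1 on a smaller ball. The functions
  \<open>y e\<close> serve to read off components of tangent vectors.\<close>

lemma local_frame:
  obtains U c r and X :: "'e \<Rightarrow> 'a vfield" and y :: "'e \<Rightarrow> 'a \<Rightarrow> real"
  where "(U, c) \<in> A" "p \<in> U" "r > 0" "ball (c p) r \<subseteq> c ` U"
    "\<And>v. X v \<in> VF" "\<And>e. y e \<in> SF"
    "\<And>q v. q \<in> U \<Longrightarrow> c q \<in> ball (c p) r \<Longrightarrow> X v q = cvec U c q v"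
    "\<And>q v e. q \<in> U \<Longrightarrow> c q \<in> ball (c p) r \<Longrightarrow> cvec U c q v (y e) = v \<bullet> e"
proof -
  obtain U c where Uc: "(U, c) \<in> A" "p \<in> U" by (rule chart_cover)
  have op: "open (c ` U)" by (rule chart_open_image[OF Uc(1)])
  obtain s where s: "s > 0" "cball (c p) s \<subseteq> c ` U"
    using op Uc(2) by (meson imageI open_contains_cball)
  \<comment> \<open>The bump function vanishes only outside the ball of radius \<open>2 * r\<close>,
    which has to fit into the chart.\<close>
  define r where "r = s / 2"
  have r: "r > 0" "cball (c p) (2 * r) \<subseteq> c ` U" using s by (auto simp: r_def)
  obtain b where b: "smooth_on UNIV b" "\<And>x. x \<in> ball (c p) r \<Longrightarrow> b x = (1::real)"
    "\<And>x. x \<notin> cball (c p) (2 * r) \<Longrightarrow> b x = 0"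
    using smooth_bump_exists[OF r(1)] by blast
  have bs: "smooth_on (c ` U) b" by (rule smooth_on_subset[OF b(1)]) auto
  have ext: "(\<lambda>q. if q \<in> U then b (c q) * u (c q) else 0) \<in> SF" if "smooth_on (c ` U) u" for u
    by (rule smooth_functions_extend_zero[OF Uc(1) compact_cball r(2), where u = "\<lambda>x. b x * u x"])
       (use b(3) in \<open>auto intro!: smooth_on_mult op bs that\<close>)
  define y where "y e q = (if q \<in> U then b (c q) * (c q \<bullet> e) else 0)" for e q
  define X where "X v q = (if q \<in> U then b (c q) *\<^sub>R cvec U c q v else 0)" for v q
  have y: "y e \<in> SF" for e
    unfolding y_def by (rule ext) (intro smooth_on_inner smooth_on_id smooth_on_const op)
  have "X v \<in> VF" for v
    unfolding vector_fields_def
  proof (intro CollectI conjI allI ballI)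
    fix q show "X v q \<in> TS q"
      using cvec_in_tangent_space[OF Uc(1)]
      by (auto simp: X_def subspace_scale[OF subspace_tangent_space] subspace_0[OF subspace_tangent_space])
  next
    fix f assume f: "f \<in> SF"
    have "act (X v) f = (\<lambda>q. if q \<in> U then b (c q) * frechet_derivative (f \<circ> inv_into U c) (at (c q)) v else 0)"
      using f by (auto simp: act_def X_def fun_eq_iff scaleR_fun_def cvec_def)
    also have "\<dots> \<in> SF"
      by (rule ext) (rule smooth_on_frechet_derivative[OF smooth_on_chart[OF Uc(1) f]])
    finally show "act (X v) f \<in> SF" .
  qed
  moreover have sub: "ball (c p) r \<subseteq> c ` U"
    using r by (auto simp: subset_iff)
  moreover have "X v q = cvec U c q v" if "q \<in> U" "c q \<in> ball (c p) r" for q v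
    using that b(2) by (simp add: X_def)
  moreover have "cvec U c q v (y e) = v \<bullet> e" if q: "q \<in> U" "c q \<in> ball (c p) r" for q v e
  proof -
    have "((\<lambda>x. x \<bullet> e) has_derivative (\<lambda>v. v \<bullet> e)) (at (c q))"
      by (auto intro!: derivative_eq_intros)
    then have "((y e \<circ> inv_into U c) has_derivative (\<lambda>v. v \<bullet> e)) (at (c q))"
    proof (rule has_derivative_transform_within_open[OF _ open_ball q(2)])
      fix x assume x: "x \<in> ball (c p) r"
      then have "inv_into U c x \<in> U" "c (inv_into U c x) = x"
        using inv_into_into[of x c U] f_inv_into_f[of x c U] subsetD[OF sub x] by simp_all
      then show "x \<bullet> e = (y e \<circ> inv_into U c) x" using x b(2) by (simp add: y_def)
    qed
    moreover have "((y e \<circ> inv_into U c) has_derivative (\<lambda>v. cvec U c q v (y e))) (at (c q))"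
      using chart_has_derivative[OF Uc(1) imageI[OF q(1)] y] q(1) Uc(1) by simp
    ultimately show ?thesis
      using has_derivative_unique by metis
  qed
  ultimately show ?thesis
    using that Uc r(1) y by blast
qed

end

subsection \<open>An algebraic lemma\<close>

text \<open>The pointwise core of the proof: \<open>t\<close>, \<open>q\<close>, \<open>b\<close>
  stand for \<open>T\<close>, \<open>\<nabla>(\<phi> h)\<close> and \<open>\<nabla>h\<close> at a
  point, \<open>C\<close> for the horizontal fields. The constraints are overdetermined: skewness of
  \<open>q\<close> in its last two slots turns into a rule for moving \<open>h\<close> between slots
  of \<open>t\<close>, and carrying \<open>\<phi> h\<close> around all three slots then costs a
  sign.\<close>

lemma three_form_vanishing:
  fixes t q b :: "'v::ab_group_add \<Rightarrow> 'v \<Rightarrow> 'v \<Rightarrow> real"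
  assumes closed: "\<And>X. X \<in> C \<Longrightarrow> f X \<in> C" "\<And>X. X \<in> C \<Longrightarrow> h X \<in> C"
    and t12: "\<And>X Y Z. X \<in> C \<Longrightarrow> Y \<in> C \<Longrightarrow> Z \<in> C \<Longrightarrow> t Y X Z = - t X Y Z"
    and t23: "\<And>X Y Z. X \<in> C \<Longrightarrow> Y \<in> C \<Longrightarrow> Z \<in> C \<Longrightarrow> t X Z Y = - t X Y Z"
    and q12: "\<And>X Y Z. X \<in> C \<Longrightarrow> Y \<in> C \<Longrightarrow> Z \<in> C \<Longrightarrow> q Y X Z = - q X Y Z"
    and q23: "\<And>X Y Z. X \<in> C \<Longrightarrow> Y \<in> C \<Longrightarrow> Z \<in> C \<Longrightarrow> q X Z Y = - q X Y Z"
    and b23: "\<And>X Y Z. X \<in> C \<Longrightarrow> Y \<in> C \<Longrightarrow> Z \<in> C \<Longrightarrow> b X Z Y = - b X Y Z"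
    and bcyc: "\<And>X Y Z. X \<in> C \<Longrightarrow> Y \<in> C \<Longrightarrow> Z \<in> C \<Longrightarrow> b X Y Z + b Y Z X + b Z X Y = 3 * t X Y Z"
    and minus: "\<And>X Y Z. X \<in> C \<Longrightarrow> Y \<in> C \<Longrightarrow> Z \<in> C \<Longrightarrow> t X Y (- Z) = - t X Y Z"
      "\<And>X Y Z. X \<in> C \<Longrightarrow> Y \<in> C \<Longrightarrow> Z \<in> C \<Longrightarrow> q X Y (- Z) = - q X Y Z"
      "\<And>X Y Z. X \<in> C \<Longrightarrow> Y \<in> C \<Longrightarrow> Z \<in> C \<Longrightarrow> b X Y (- Z) = - b X Y Z"
    and tf: "\<And>X Y Z. X \<in> C \<Longrightarrow> Y \<in> C \<Longrightarrow> Z \<in> C \<Longrightarrow> t X (f Y) Z = t X Y (f Z)"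
    and ff: "\<And>X. X \<in> C \<Longrightarrow> f (f X) = - X"
    and fhf: "\<And>X. X \<in> C \<Longrightarrow> f (h (f X)) = h X"
    and q: "\<And>X Y Z. X \<in> C \<Longrightarrow> Y \<in> C \<Longrightarrow> Z \<in> C \<Longrightarrow> q X Y Z = t X (h Y) Z - b X Y (f Z)"
    and XYZ: "X \<in> C" "Y \<in> C" "Z \<in> C"
  shows "t (h X) Y Z = 0" and "b X Y Z = t X Y Z"
proof -
  note [simp] = closed
  \<comment> \<open>\<open>n\<close> is \<open>b\<close> plus the action of \<open>f h\<close> on
    the last two slots of \<open>t\<close>. That correction is skew in these slots, so
    \<open>n\<close> inherits skewness there from \<open>b\<close>, and in the first two slots from
    \<open>q\<close>: it is alternating.\<close>
  define n where "n X Y Z = q X Y (f Z) + t X Y (f (h Z))" for X Y Z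
  have b: "b X Y Z = n X Y Z - t X Y (f (h Z)) - t X (f (h Y)) Z"
    if "X \<in> C" "Y \<in> C" "Z \<in> C" for X Y Z
    using that q[of X Y "f Z"] tf[of X "h Y" Z] by (simp add: n_def ff minus)
  have n12: "n Y X Z = - n X Y Z" if "X \<in> C" "Y \<in> C" "Z \<in> C" for X Y Z
    using that q12[of X Y "f Z"] t12[of X Y "f (h Z)"] by (simp add: n_def)
  have n23: "n X Z Y = - n X Y Z" if "X \<in> C" "Y \<in> C" "Z \<in> C" for X Y Z
    using that b[of X Y Z] b[of X Z Y] b23[of X Y Z] t23[of X Y "f (h Z)"] t23[of X "f (h Y)" Z] by simp
  \<comment> \<open>The cyclic sum of the alternating \<open>n\<close> is \<open>3 n\<close>; in the
    cyclic sum of \<open>b\<close> every slot of \<open>t\<close> is corrected twice.\<close>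
  have n: "3 * n X Y Z = 3 * t X Y Z + 2 * (t (f (h X)) Y Z + t X (f (h Y)) Z + t X Y (f (h Z)))"
    if "X \<in> C" "Y \<in> C" "Z \<in> C" for X Y Z
  proof -
    let ?h = "\<lambda>X. f (h X)"
    have "n Y Z X = n X Y Z" "n Z X Y = n X Y Z"
      using that n12[of X Y Z] n23[of Y X Z] n23[of X Z Y] n12[of X Z Y] by simp_all
    moreover have "t Y Z (?h X) = t (?h X) Y Z" "t Y (?h Z) X = t X Y (?h Z)" "t Z X (?h Y) = t X (?h Y) Z"
       "t Z (?h X) Y = t (?h X) Y Z"
      using that t12[of "?h X" Y Z] t23[of Y "?h X" Z] t12[of X Y "?h Z"] t23[of Y X "?h Z"]
        t12[of X Z "?h Y"] t23[of X Z "?h Y"] t12[of "?h X" Z Y] t23[of "?h X" Z Y] by simp_all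
    ultimately show ?thesis
      using that bcyc[of X Y Z] b[of X Y Z] b[of Y Z X] b[of Z X Y] by simp
  qed
  have t12f: "t (f X) Y Z = t X (f Y) Z" if "X \<in> C" "Y \<in> C" "Z \<in> C" for X Y Z
    using that tf[of Z X Y] t12[of Z "f X" Y] t23[of "f X" Z Y] t12[of Z X "f Y"] t23[of X Z "f Y"] by simp
  have th: "t X (h Y) Z = t X Y (h Z)" if "X \<in> C" "Y \<in> C" "Z \<in> C" for X Y Z
  proof -
    \<comment> \<open>The last coefficient is -2 + 3 = 1, against 2 in the other slots, because
      \<open>q\<close> itself differs from \<open>- n X Y (f Z)\<close> by
      \<open>t X Y (h Z)\<close>. This imbalance is what skewness of \<open>q\<close>
      detects.\<close>
    have qn: "3 * q X Y Z = - 3 * t X Y (f Z) + 2 * (t (h X) Y Z + t X (h Y) Z) + t X Y (h Z)"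
      if "X \<in> C" "Y \<in> C" "Z \<in> C" for X Y Z
    proof -
      have "q X Y Z = - n X Y (f Z) + t X Y (h Z)"
        using that by (simp add: n_def ff fhf minus)
      moreover have neg: "t (- X) Y Z = - t X Y Z" "t X (- Y) Z = - t X Y Z" if "X \<in> C" "Y \<in> C" "Z \<in> C" for X Y Z
      proof -
        have m: "- X = f (f X)" "- Y = f (f Y)" "- X \<in> C" "- Y \<in> C"
          using that ff[of X] ff[of Y] closed(1)[of "f X"] closed(1)[of "f Y"] by auto
        show "t X (- Y) Z = - t X Y Z"
          using that m t23[of X Z "- Y"] minus(1)[of X Z Y] t23[of X Z Y] by simp
        show "t (- X) Y Z = - t X Y Z"
          using that m t12[of Y "- X" Z] t23[of Y Z "- X"] minus(1)[of Y Z X] t23[of Y Z X] t12[of Y X Z] by simp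
      qed
      have "t (f (h X)) Y (f Z) = - t (h X) Y Z"
        using that tf[of "f (h X)" Y Z] t12f[of "f (h X)" Y Z] by (simp add: ff neg)
      moreover have "t X (f (h Y)) (f Z) = - t X (h Y) Z"
        using that tf[of X "f (h Y)" Z] by (simp add: ff neg)
      ultimately show ?thesis
        using that n[of X Y "f Z"] by (simp add: fhf)
    qed
    show ?thesis
      using that qn[of X Y Z] qn[of X Z Y] q23[of X Y Z] t23[of X Y "f Z"] t23[of "h X" Y Z]
        t23[of X "h Y" Z] t23[of X Y "h Z"] tf[of X Y Z] t23[of X "f Y" Z] by simp
  qed
  have psi0: "t X Y (f (h Z)) = 0" if "X \<in> C" "Y \<in> C" "Z \<in> C" for X Y Z
  proof -
    let ?h = "\<lambda>X. f (h X)"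
    \<comment> \<open>Moving \<open>f h\<close> to another slot changes the sign: \<open>f\<close>
      moves by \<open>tf\<close>, \<open>h\<close> by \<open>th\<close>, and the two anticommute.
      After three moves the term equals its own negative.\<close>
    have *: "t X (?h Y) Z = - t X Y (?h Z)" if "X \<in> C" "Y \<in> C" "Z \<in> C" for X Y Z
    proof -
      have "h (f Z) = - f (h Z)"
        using that ff[of "h (f Z)"] by (simp add: fhf eq_neg_iff_add_eq_0 neg_eq_iff_add_eq_0 add.commute)
      then show ?thesis
        using that tf[of X "h Y" Z] th[of X Y "f Z"] by (simp add: minus)
    qed
    show ?thesis
      using that *[of X Y Z] *[of Z X Y] *[of Y X Z]
        t12[of X Y "?h Z"] t12[of X Z "?h Y"] t12[of Z "?h X" Y] t23[of "?h X" Z Y] t23[of X Z "?h Y"]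
        t12[of Y "?h X" Z] t12[of Z Y "?h X"]  t23[of Y Z "?h X"] by simp
  qed
  have psi0': "t X (f (h Y)) Z = 0" if "X \<in> C" "Y \<in> C" "Z \<in> C" for X Y Z
    using that psi0[of X Z Y] t23[of X Z "f (h Y)"] by simp
  have psi0'': "t (f (h X)) Y Z = 0" if "X \<in> C" "Y \<in> C" "Z \<in> C" for X Y Z
    using that psi0'[of Y X Z] t12[of Y "f (h X)" Z] by simp
  show "t (h X) Y Z = 0"
    using psi0''[of "f X" Y Z] XYZ fhf[of X] by simp
  show "b X Y Z = t X Y Z"
    using XYZ b n psi0 psi0' psi0'' by simp
qed

subsection \<open>Covariant calculus on a nearly Sasakian manifold\<close>

locale nearly_sasakian_manifold = atlas A
  for A :: "('a::{t2_space,second_countable_topology}, 'e::euclidean_space) chart set" +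
  fixes nabla :: "'a vfield \<Rightarrow> 'a vfield \<Rightarrow> 'a vfield"
    and \<phi> h :: "'a endo_field" and \<xi> :: "'a vfield"
    and \<eta> :: "'a \<Rightarrow> 'a tangent \<Rightarrow> real"
    and g :: "'a \<Rightarrow> 'a tangent \<Rightarrow> 'a tangent \<Rightarrow> real"
  assumes ns: "nearly_sasakian A nabla \<phi> \<xi> \<eta> g"
    and h: "tensor_field_11 A h"
    and nabla_xi: "\<forall>X\<in>vector_fields A. nabla X \<xi> = - app \<phi> X + app h X"
begin

abbreviation "N \<equiv> nabla"
abbreviation "P \<equiv> app \<phi>"
abbreviation "H \<equiv> app h"

definition G :: "'a vfield \<Rightarrow> 'a vfield \<Rightarrow> 'a \<Rightarrow> real"
  where "G X Y p = g p (X p) (Y p)"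

lemma acm: "almost_contact_metric A \<phi> \<xi> \<eta> g" and lc: "levi_civita A g nabla"
  and aff: "affine_connection A nabla"
  using ns by (auto simp: nearly_sasakian_def levi_civita_def)

lemma phi: "tensor_field_11 A \<phi>" and eta: "one_form A \<eta>" and met: "riemannian_metric A g"
  using acm by (auto simp: almost_contact_metric_def)

lemma xi_VF [simp]: "\<xi> \<in> VF"
  using acm by (simp add: almost_contact_metric_def)

lemma P_VF [simp]: "X \<in> VF \<Longrightarrow> P X \<in> VF" and H_VF [simp]: "X \<in> VF \<Longrightarrow> H X \<in> VF"
  using phi h by (auto simp: tensor_field_11_def)

lemma N_VF [simp]: "X \<in> VF \<Longrightarrow> Y \<in> VF \<Longrightarrow> N X Y \<in> VF"
  using aff by (auto simp: affine_connection_def)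

lemmas [simp] = VF_add VF_diff VF_minus VF_0 VF_fmult SF_const SF_0 SF_add SF_mult SF_minus SF_diff
  VF_act

lemma G_SF [simp]: "X \<in> VF \<Longrightarrow> Y \<in> VF \<Longrightarrow> G X Y \<in> SF"
  using met by (auto simp: riemannian_metric_def G_def[abs_def])

lemma TS_closed [simp]:
  "v \<in> TS p \<Longrightarrow> w \<in> TS p \<Longrightarrow> v + w \<in> TS p" "v \<in> TS p \<Longrightarrow> w \<in> TS p \<Longrightarrow> v - w \<in> TS p"
  "v \<in> TS p \<Longrightarrow> - v \<in> TS p" "v \<in> TS p \<Longrightarrow> k *\<^sub>R v \<in> TS p" "0 \<in> TS p"
  using subspace_tangent_space[of p] by (auto simp: subspace_add subspace_diff subspace_neg subspace_scale subspace_0)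

lemma linear_on_set_rules:
  assumes "linear_on_set (TS p) L"
  shows "v \<in> TS p \<Longrightarrow> w \<in> TS p \<Longrightarrow> L (v + w) = L v + L w" "v \<in> TS p \<Longrightarrow> L (k *\<^sub>R v) = k *\<^sub>R L v"
    "v \<in> TS p \<Longrightarrow> L (- v) = - L v" "v \<in> TS p \<Longrightarrow> w \<in> TS p \<Longrightarrow> L (v - w) = L v - L w" "L 0 = 0"
proof -
  show a: "L (v + w) = L v + L w" if "v \<in> TS p" "w \<in> TS p" for v w
    using assms that by (simp add: linear_on_set_def)
  show s: "L (k *\<^sub>R v) = k *\<^sub>R L v" if "v \<in> TS p" for v k
    using assms that by (simp add: linear_on_set_def)
  show m: "L (- v) = - L v" if "v \<in> TS p" for v
    using s[OF that, of "-1"] by simp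
  show "L (v - w) = L v - L w" if "v \<in> TS p" "w \<in> TS p" for v w
    using a[of v "- w"] m[of w] that by simp
  show "L 0 = 0" using s[of 0 0] by simp
qed

lemma phi_TS [simp]: "v \<in> TS p \<Longrightarrow> \<phi> p v \<in> TS p" and h_TS [simp]: "v \<in> TS p \<Longrightarrow> h p v \<in> TS p"
  using phi h unfolding tensor_field_11_def by blast+

lemma xi_TS [simp]: "\<xi> p \<in> TS p"
  by (simp add: VF_tangent)

lemma phi_linear: "linear_on_set (TS p) (\<phi> p)" and h_linear: "linear_on_set (TS p) (h p)"
  and eta_linear: "linear_on_set (TS p) (\<eta> p)"
  using phi h eta by (auto simp: tensor_field_11_def one_form_def)

lemma g_linear_right: "v \<in> TS p \<Longrightarrow> linear_on_set (TS p) (g p v)"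
  using met by (auto simp: riemannian_metric_def)

lemma g_sym: "v \<in> TS p \<Longrightarrow> w \<in> TS p \<Longrightarrow> g p v w = g p w v"
  using met by (auto simp: riemannian_metric_def)

lemma g_linear_left: "v \<in> TS p \<Longrightarrow> linear_on_set (TS p) (\<lambda>w. g p w v)"
  using g_linear_right[of v p] g_sym[of v p] unfolding linear_on_set_def by (metis TS_closed(1) TS_closed(4) g_sym)

lemma g_pos: "v \<in> TS p \<Longrightarrow> v \<noteq> 0 \<Longrightarrow> g p v v > 0"
  using met by (auto simp: riemannian_metric_def)

lemmas g_rules = linear_on_set_rules[OF g_linear_right] linear_on_set_rules[OF g_linear_left]
lemmas phi_rules = linear_on_set_rules[OF phi_linear]
lemmas h_rules = linear_on_set_rules[OF h_linear]
lemmas eta_rules = linear_on_set_rules[OF eta_linear]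

lemma phi_phi: "v \<in> TS p \<Longrightarrow> \<phi> p (\<phi> p v) = - v + \<eta> p v *\<^sub>R \<xi> p"
  and eta_xi: "\<eta> p (\<xi> p) = 1"
  and g_phi_phi: "v \<in> TS p \<Longrightarrow> w \<in> TS p \<Longrightarrow> g p (\<phi> p v) (\<phi> p w) = g p v w - \<eta> p v * \<eta> p w"
  using acm by (auto simp: almost_contact_metric_def)

text \<open>\<open>\<phi> \<xi>\<close> lies in the kernel of \<open>\<phi>\<close>, so the formula
  for \<open>\<phi>\<^sup>2\<close> makes it a multiple \<open>k \<xi>\<close>; applying
  \<open>\<phi>\<close> again gives \<open>k\<^sup>2 \<xi> = 0\<close>.\<close>

lemma phi_xi: "\<phi> p (\<xi> p) = 0"
proof -
  define k where "k = \<eta> p (\<phi> p (\<xi> p))"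
  have 0: "\<phi> p (\<phi> p (\<xi> p)) = 0" by (simp add: phi_phi eta_xi)
  then have 1: "\<phi> p (\<xi> p) = k *\<^sub>R \<xi> p"
    using phi_phi[of "\<phi> p (\<xi> p)" p] by (simp add: phi_rules k_def)
  then have "(k * k) *\<^sub>R \<xi> p = 0"
    using 0 phi_rules(2)[of "\<xi> p" p k] by simp
  moreover have "\<xi> p \<noteq> 0" using eta_xi[of p] eta_rules(5)[of p] by auto
  ultimately show ?thesis using 1 by simp
qed

lemma eta_phi: "v \<in> TS p \<Longrightarrow> \<eta> p (\<phi> p v) = 0"
proof -
  assume v: "v \<in> TS p"
  have "\<phi> p (\<phi> p (\<phi> p v)) = - \<phi> p v"
    using v by (simp add: phi_phi[OF v] phi_rules phi_xi)
  then have "\<eta> p (\<phi> p v) *\<^sub>R \<xi> p = 0"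
    using phi_phi[of "\<phi> p v" p] v by simp
  moreover have "\<xi> p \<noteq> 0" using eta_xi[of p] eta_rules(5)[of p] by auto
  ultimately show ?thesis by simp
qed

lemma eta_eq: "v \<in> TS p \<Longrightarrow> \<eta> p v = g p v (\<xi> p)"
  using g_phi_phi[of v p "\<xi> p"] by (simp add: phi_xi eta_xi g_rules)

lemma g_phi_skew: "v \<in> TS p \<Longrightarrow> w \<in> TS p \<Longrightarrow> g p (\<phi> p v) w = - g p v (\<phi> p w)"
  using g_phi_phi[of "\<phi> p v" p w] by (simp add: phi_phi eta_phi g_rules eta_eq[symmetric] g_sym[of "\<xi> p"])

subsubsection \<open>Rules for fields\<close>

lemma G_sym: "X \<in> VF \<Longrightarrow> Y \<in> VF \<Longrightarrow> G X Y = G Y X"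
  by (simp add: G_def g_sym VF_tangent fun_eq_iff)

lemma G_rules [simp]:
  "X \<in> VF \<Longrightarrow> Y \<in> VF \<Longrightarrow> Z \<in> VF \<Longrightarrow> G (X + Y) Z p = G X Z p + G Y Z p"
  "X \<in> VF \<Longrightarrow> Y \<in> VF \<Longrightarrow> Z \<in> VF \<Longrightarrow> G Z (X + Y) p = G Z X p + G Z Y p"
  "X \<in> VF \<Longrightarrow> Y \<in> VF \<Longrightarrow> Z \<in> VF \<Longrightarrow> G (X - Y) Z p = G X Z p - G Y Z p"
  "X \<in> VF \<Longrightarrow> Y \<in> VF \<Longrightarrow> Z \<in> VF \<Longrightarrow> G Z (X - Y) p = G Z X p - G Z Y p"
  "X \<in> VF \<Longrightarrow> Z \<in> VF \<Longrightarrow> G (- X) Z p = - G X Z p"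
  "X \<in> VF \<Longrightarrow> Z \<in> VF \<Longrightarrow> G Z (- X) p = - G Z X p"
  "X \<in> VF \<Longrightarrow> Z \<in> VF \<Longrightarrow> G (fmult f X) Z p = f p * G X Z p"
  "X \<in> VF \<Longrightarrow> Z \<in> VF \<Longrightarrow> G Z (fmult f X) p = f p * G Z X p"
  "Z \<in> VF \<Longrightarrow> G 0 Z p = 0" "Z \<in> VF \<Longrightarrow> G Z 0 p = 0"
  by (simp_all add: G_def g_rules VF_tangent fmult_def)

lemma G_xi_xi [simp]: "G \<xi> \<xi> p = 1"
  by (simp add: G_def eta_eq[symmetric] eta_xi)

lemma G_eqI:
  assumes "X \<in> VF" "Y \<in> VF" "\<And>Z p. Z \<in> VF \<Longrightarrow> G X Z p = G Y Z p"
  shows "X = Y"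
proof
  fix p
  have "G (X - Y) (X - Y) p = 0"
    using assms(1,2) assms(3)[of "X - Y" p] by simp
  then have "(X - Y) p = 0"
    using g_pos[OF VF_tangent, of "X - Y" p] assms(1,2) unfolding G_def by fastforce
  then show "X p = Y p" by simp
qed

lemma G_fun [simp]:
  "X \<in> VF \<Longrightarrow> Y \<in> VF \<Longrightarrow> Z \<in> VF \<Longrightarrow> G (X + Y) Z = G X Z + G Y Z"
  "X \<in> VF \<Longrightarrow> Y \<in> VF \<Longrightarrow> Z \<in> VF \<Longrightarrow> G (X - Y) Z = G X Z - G Y Z"
  "X \<in> VF \<Longrightarrow> Z \<in> VF \<Longrightarrow> G (- X) Z = - G X Z"
  "Z \<in> VF \<Longrightarrow> G 0 Z = 0" "Z \<in> VF \<Longrightarrow> G Z 0 = 0"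
  by (simp_all add: fun_eq_iff)

lemma P_rules [simp]:
  "X \<in> VF \<Longrightarrow> Y \<in> VF \<Longrightarrow> P (X + Y) = P X + P Y"
  "X \<in> VF \<Longrightarrow> Y \<in> VF \<Longrightarrow> P (X - Y) = P X - P Y"
  "X \<in> VF \<Longrightarrow> P (- X) = - P X"
  "X \<in> VF \<Longrightarrow> P (fmult f X) = fmult f (P X)"
  "P 0 = 0"
  by (auto simp: app_def fun_eq_iff phi_rules VF_tangent fmult_def)

lemma H_rules [simp]:
  "X \<in> VF \<Longrightarrow> Y \<in> VF \<Longrightarrow> H (X + Y) = H X + H Y"
  "X \<in> VF \<Longrightarrow> Y \<in> VF \<Longrightarrow> H (X - Y) = H X - H Y"
  "X \<in> VF \<Longrightarrow> H (- X) = - H X"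
  "X \<in> VF \<Longrightarrow> H (fmult f X) = fmult f (H X)"
  "H 0 = 0"
  by (auto simp: app_def fun_eq_iff h_rules VF_tangent fmult_def)

lemma P_xi [simp]: "P \<xi> = 0"
  by (simp add: app_def phi_xi fun_eq_iff)

lemma P_P [simp]: "X \<in> VF \<Longrightarrow> P (P X) = - X + fmult (G X \<xi>) \<xi>"
  by (auto simp: app_def phi_phi VF_tangent eta_eq fmult_def G_def fun_eq_iff)

lemma G_P_xi [simp]: "X \<in> VF \<Longrightarrow> G (P X) \<xi> p = 0"
  by (simp add: G_def app_def eta_eq[symmetric] VF_tangent eta_phi)

lemma G_P: "X \<in> VF \<Longrightarrow> Y \<in> VF \<Longrightarrow> G (P X) Y p = - G X (P Y) p"
  by (simp add: G_def app_def g_phi_skew VF_tangent)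

lemma N_rules [simp]:
  "X \<in> VF \<Longrightarrow> Y \<in> VF \<Longrightarrow> Z \<in> VF \<Longrightarrow> N (X + Y) Z = N X Z + N Y Z"
  "X \<in> VF \<Longrightarrow> Y \<in> VF \<Longrightarrow> Z \<in> VF \<Longrightarrow> N X (Y + Z) = N X Y + N X Z"
  "f \<in> SF \<Longrightarrow> X \<in> VF \<Longrightarrow> Y \<in> VF \<Longrightarrow> N (fmult f X) Y = fmult f (N X Y)"
  "f \<in> SF \<Longrightarrow> X \<in> VF \<Longrightarrow> Y \<in> VF \<Longrightarrow> N X (fmult f Y) = fmult (act X f) Y + fmult f (N X Y)"
  using aff by (auto simp: affine_connection_def)

lemma act_rules:
  "X \<in> VF \<Longrightarrow> f \<in> SF \<Longrightarrow> k \<in> SF \<Longrightarrow> act X (f + k) = act X f + act X k"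
  "X \<in> VF \<Longrightarrow> f \<in> SF \<Longrightarrow> act X (- f) = - act X f"
  "X \<in> VF \<Longrightarrow> f \<in> SF \<Longrightarrow> k \<in> SF \<Longrightarrow> act X (f - k) = act X f - act X k"
  "X \<in> VF \<Longrightarrow> act X (\<lambda>p. c) = 0"
  "X \<in> VF \<Longrightarrow> act X 0 = 0"
proof -
  show "act X (f + k) = act X f + act X k" if "X \<in> VF" "f \<in> SF" "k \<in> SF" for X f k
    using that by (auto simp: act_def fun_eq_iff tangent_add[OF VF_tangent, unfolded plus_fun_def] plus_fun_def)
  moreover show "act X (- f) = - act X f" if "X \<in> VF" "f \<in> SF" for X f
    using that by (auto simp: act_def fun_eq_iff tangent_minus[OF VF_tangent, unfolded fun_Compl_def] fun_Compl_def)
  ultimately show "act X (f - k) = act X f - act X k" if "X \<in> VF" "f \<in> SF" "k \<in> SF" for X f k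
    using that by (metis (no_types) SF_minus diff_conv_add_uminus)
  show c: "act X (\<lambda>p. c) = 0" if "X \<in> VF" for X c
    using that by (auto simp: act_def fun_eq_iff tangent_const[OF VF_tangent])
  show "act X 0 = 0" if "X \<in> VF" for X
    using c[OF that, of 0] by (simp add: zero_fun_def)
qed

lemma fmult_simps [simp]: "fmult 0 X = 0" "fmult (\<lambda>p. 1) X = X" "fmult f 0 = 0" "fmult (- f) X = - fmult f X"
  by (auto simp: fmult_def fun_eq_iff)

lemma N_minus_zero [simp]:
  "X \<in> VF \<Longrightarrow> Y \<in> VF \<Longrightarrow> N X (- Y) = - N X Y" "X \<in> VF \<Longrightarrow> Y \<in> VF \<Longrightarrow> N (- X) Y = - N X Y"
  "X \<in> VF \<Longrightarrow> N X 0 = 0" "X \<in> VF \<Longrightarrow> N 0 X = 0"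
  "X \<in> VF \<Longrightarrow> Y \<in> VF \<Longrightarrow> Z \<in> VF \<Longrightarrow> N X (Y - Z) = N X Y - N X Z"
  "X \<in> VF \<Longrightarrow> Y \<in> VF \<Longrightarrow> Z \<in> VF \<Longrightarrow> N (X - Y) Z = N X Z - N Y Z"
proof -
  have z1: "N X 0 = 0" and z2: "N 0 X = 0" if "X \<in> VF" for X
    using that N_rules(2)[of X 0 0] N_rules(1)[of 0 0 X] by simp_all
  have m1: "N X (- Y) = - N X Y" and m2: "N (- X) Y = - N X Y" if "X \<in> VF" "Y \<in> VF" for X Y
    using that N_rules(2)[of X Y "- Y"] N_rules(1)[of X "- X" Y] z1[of X] z2[of Y]
    by (simp_all add: eq_neg_iff_add_eq_0 add.commute)
  show "X \<in> VF \<Longrightarrow> Y \<in> VF \<Longrightarrow> N X (- Y) = - N X Y" "X \<in> VF \<Longrightarrow> Y \<in> VF \<Longrightarrow> N (- X) Y = - N X Y"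
    "X \<in> VF \<Longrightarrow> N X 0 = 0" "X \<in> VF \<Longrightarrow> N 0 X = 0" by (fact m1 m2 z1 z2)+
  show "X \<in> VF \<Longrightarrow> Y \<in> VF \<Longrightarrow> Z \<in> VF \<Longrightarrow> N X (Y - Z) = N X Y - N X Z"
    using N_rules(2)[of X Y "- Z"] m1[of X Z] by simp
  show "X \<in> VF \<Longrightarrow> Y \<in> VF \<Longrightarrow> Z \<in> VF \<Longrightarrow> N (X - Y) Z = N X Z - N Y Z"
    using N_rules(1)[of X "- Y" Z] m2[of Y Z] by simp
qed

lemma N_xi [simp]: "X \<in> VF \<Longrightarrow> N X \<xi> = - P X + H X"
  using nabla_xi by simp

lemma act_G: "X \<in> VF \<Longrightarrow> Y \<in> VF \<Longrightarrow> Z \<in> VF \<Longrightarrow> act X (G Y Z) = G (N X Y) Z + G Y (N X Z)"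
  using lc by (auto simp: levi_civita_def G_def[abs_def] plus_fun_def)

text \<open>Since the connection is torsion-free, this is the Lie bracket.\<close>
definition br :: "'a vfield \<Rightarrow> 'a vfield \<Rightarrow> 'a vfield"
  where "br X Y = N X Y - N Y X"

lemma br_VF [simp]: "X \<in> VF \<Longrightarrow> Y \<in> VF \<Longrightarrow> br X Y \<in> VF"
  by (simp add: br_def)

lemma br_eq: "X \<in> VF \<Longrightarrow> Y \<in> VF \<Longrightarrow> br X Y = lie_bracket X Y"
  using lc by (simp add: levi_civita_def br_def)

lemma act_br: "X \<in> VF \<Longrightarrow> Y \<in> VF \<Longrightarrow> act (br X Y) f = act X (act Y f) - act Y (act X f)"
  by (simp add: br_eq act_def lie_bracket_def fun_eq_iff)

lemma jacobi:
  assumes "X \<in> VF" "Y \<in> VF" "Z \<in> VF"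
  shows "br X (br Y Z) = br (br X Y) Z + br Y (br X Z)"
proof (intro ext)
  fix p f
  have "act (br X (br Y Z)) f = act (br (br X Y) Z) f + act (br Y (br X Z)) f"
  proof (cases "f \<in> SF")
    case True
    then show ?thesis using assms by (simp add: act_br act_rules)
  next
    \<comment> \<open>The sum rules for \<open>act\<close> need smooth functions. On all others
      every tangent vector is 0 by convention, so both sides vanish.\<close>
    case False
    then have "act W f = 0" if "W \<in> VF" for W
      using that tangent_nonsmooth[OF VF_tangent] by (auto simp: act_def fun_eq_iff)
    then show ?thesis using assms by simp
  qed
  then show "br X (br Y Z) p f = (br (br X Y) Z + br Y (br X Z)) p f"
    by (simp add: act_def fun_eq_iff)
qed

subsubsection \<open>Pointwise identities\<close>

text \<open>\<open>\<xi>\<close> has constant length, so \<open>\<nabla>\<^sub>X \<xi>\<close> is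
  orthogonal to it; \<open>\<phi> X\<close> is as well, and hence so is \<open>h X\<close>.\<close>

lemma G_xi_zero [simp]:
  "X \<in> VF \<Longrightarrow> G (P X) \<xi> = 0" "X \<in> VF \<Longrightarrow> G \<xi> (P X) = 0"
  "X \<in> VF \<Longrightarrow> G (H X) \<xi> = 0" "X \<in> VF \<Longrightarrow> G \<xi> (H X) = 0"
proof -
  show P: "G (P X) \<xi> = 0" if "X \<in> VF" for X
    using that by (simp add: fun_eq_iff)
  show "G \<xi> (P X) = 0" if "X \<in> VF" for X
    using that P[OF that] by (simp add: G_sym[of \<xi> "P X"])
  show H: "G (H X) \<xi> = 0" if X: "X \<in> VF" for X
  proof
    fix p
    have "G \<xi> \<xi> = (\<lambda>p. 1)" by (simp add: fun_eq_iff)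
    then have "act X (G \<xi> \<xi>) p = 0" using act_rules(4)[OF X, of 1] by simp
    then show "G (H X) \<xi> p = 0 p"
      using X P[OF X] act_G[OF X xi_VF xi_VF] G_sym[of \<xi> "P X"] G_sym[of \<xi> "H X"] by simp
  qed
  show "G \<xi> (H X) = 0" if "X \<in> VF" for X
    using that H[OF that] by (simp add: G_sym[of \<xi> "H X"])
qed

section \<open>The 3-form and the algebraic identities for \<open>h\<close>\<close>

definition F :: "'a vfield \<Rightarrow> 'a vfield \<Rightarrow> 'a vfield"
  where "F X Y = N X (P Y) - P (N X Y)"

text \<open>The defect from the Sasakian identity
  \<open>(\<nabla>\<^sub>X \<phi>) Y = g X Y \<xi> - \<eta> Y X\<close>, lowered with the
  metric.\<close>

definition T :: "'a vfield \<Rightarrow> 'a vfield \<Rightarrow> 'a vfield \<Rightarrow> 'a \<Rightarrow> real"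
  where "T X Y Z p = G (F X Y) Z p - G X Y p * G Z \<xi> p + G Y \<xi> p * G X Z p"

lemma F_VF [simp]: "X \<in> VF \<Longrightarrow> Y \<in> VF \<Longrightarrow> F X Y \<in> VF"
  by (simp add: F_def)

lemma SF_double [simp]: "f \<in> SF \<Longrightarrow> 2 * f \<in> SF"
  by (metis SF_add mult_2)

lemma act_double: "X \<in> VF \<Longrightarrow> f \<in> SF \<Longrightarrow> act X (2 * f) = 2 * act X f"
  using act_rules(1)[of X f f] by (metis mult_2)

lemma F_nearly_sasakian:
  assumes "X \<in> VF" "Y \<in> VF"
  shows "F X Y + F Y X =
    fmult (G X Y + G X Y) \<xi> - fmult (G X \<xi>) Y - fmult (G Y \<xi>) X"
proof -
  have "(\<lambda>p. 2 * g p (X p) (Y p)) = G X Y + G X Y" "(\<lambda>p. \<eta> p (X p)) = G X \<xi>" "(\<lambda>p. \<eta> p (Y p)) = G Y \<xi>"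
    using assms by (auto simp: G_def fun_eq_iff eta_eq VF_tangent)
  moreover have "F X Y + F Y X = fmult (\<lambda>p. 2 * g p (X p) (Y p)) \<xi> - fmult (\<lambda>p. \<eta> p (X p)) Y - fmult (\<lambda>p. \<eta> p (Y p)) X"
    using ns assms by (auto simp: nearly_sasakian_def F_def cov_deriv_def)
  ultimately show ?thesis by simp
qed

text \<open>Differentiate \<open>g (B Y) Z = - g Y (B Z)\<close> with the metric connection. It is
  applied to \<open>\<phi>\<close>, \<open>\<phi> h\<close> and \<open>h\<close>.\<close>

lemma skew_cov_deriv:
  assumes B: "\<And>X. X \<in> VF \<Longrightarrow> B X \<in> VF" "\<And>X Y p. X \<in> VF \<Longrightarrow> Y \<in> VF \<Longrightarrow> G (B X) Y p = - G X (B Y) p"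
    and XYZ: "X \<in> VF" "Y \<in> VF" "Z \<in> VF"
  shows "G (N X (B Y) - B (N X Y)) Z p = - G (N X (B Z) - B (N X Z)) Y p"
proof -
  note [simp] = B(1) XYZ
  have "G (B Y) Z = - G Y (B Z)" by (simp add: fun_eq_iff B(2))
  then have "act X (G (B Y) Z) p = - act X (G Y (B Z)) p" by (simp add: act_rules)
  then show ?thesis
    using B(2)[of "N X Y" Z p] B(2)[of "N X Z" Y p] G_sym[of "N X Z" "B Y"] G_sym[of "N X (B Z)" Y]
    by (simp add: act_G)
qed

lemma F_skew: "X \<in> VF \<Longrightarrow> Y \<in> VF \<Longrightarrow> Z \<in> VF \<Longrightarrow> G (F X Y) Z p = - G (F X Z) Y p"
  unfolding F_def by (rule skew_cov_deriv) (simp_all add: G_P)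

lemma T_alt12: "X \<in> VF \<Longrightarrow> Y \<in> VF \<Longrightarrow> Z \<in> VF \<Longrightarrow> T Y X Z p = - T X Y Z p"
proof -
  assume [simp]: "X \<in> VF" "Y \<in> VF" "Z \<in> VF"
  have "G (F X Y) Z p + G (F Y X) Z p =
      (G X Y p + G X Y p) * G \<xi> Z p - G X \<xi> p * G Y Z p - G Y \<xi> p * G X Z p"
    using arg_cong[OF F_nearly_sasakian[of X Y], of "\<lambda>W. G W Z p"] by simp
  then show ?thesis
    by (simp add: T_def G_sym[of \<xi> Z] G_sym[of Y X] algebra_simps)
qed

lemma T_alt23: "X \<in> VF \<Longrightarrow> Y \<in> VF \<Longrightarrow> Z \<in> VF \<Longrightarrow> T X Z Y p = - T X Y Z p"
  using F_skew[of X Y Z p] by (simp add: T_def)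

lemma F_xi_right: "X \<in> VF \<Longrightarrow> F X \<xi> = P (P X) - P (H X)"
  by (simp add: F_def del: P_P)

text \<open>The alternating \<open>T\<close> vanishes on \<open>\<xi>, \<xi>, Z\<close>, which says
  \<open>\<phi> (h \<xi>) = 0\<close>; since \<open>h \<xi>\<close> is also orthogonal to
  \<open>\<xi>\<close>, applying \<open>\<phi>\<close> once more leaves
  \<open>h \<xi> = 0\<close>.\<close>

lemma H_xi [simp]: "H \<xi> = 0"
proof -
  have "P (H \<xi>) = 0"
  proof (rule G_eqI)
    fix Z p assume [simp]: "Z \<in> VF"
    have "T \<xi> \<xi> Z p = 0" using T_alt12[of \<xi> \<xi> Z p] by simp
    then show "G (P (H \<xi>)) Z p = G 0 Z p"
      by (simp add: T_def F_xi_right G_sym[of \<xi> Z] del: P_P)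
  qed simp_all
  then have "P (P (H \<xi>)) = 0" by (simp del: P_P)
  then show ?thesis by simp
qed

lemma T_xi: "X \<in> VF \<Longrightarrow> Z \<in> VF \<Longrightarrow> T X \<xi> Z p = - G (P (H X)) Z p"
  by (simp add: T_def F_xi_right G_sym[of \<xi> Z])

text \<open>By \<open>T_xi\<close>, \<open>\<phi> h\<close> represents up to sign the contraction of
  the 3-form \<open>T\<close> with \<open>\<xi>\<close>.\<close>

lemma PH_skew': "X \<in> VF \<Longrightarrow> Y \<in> VF \<Longrightarrow> G (P (H X)) Y p = - G (P (H Y)) X p"
  using T_xi[of X Y p] T_xi[of Y X p] T_alt12[of X \<xi> Y p] T_alt23[of \<xi> X Y p] T_alt12[of Y \<xi> X p]
  by simp

lemma F_xi_left: "Y \<in> VF \<Longrightarrow> F \<xi> Y = P (H Y)"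
proof (rule G_eqI)
  fix Z p assume [simp]: "Y \<in> VF" "Z \<in> VF"
  have "T \<xi> Y Z p = G (P (H Y)) Z p"
    using T_alt12[of Y \<xi> Z p] T_xi[of Y Z p] by simp
  then show "G (F \<xi> Y) Z p = G (P (H Y)) Z p"
    by (simp add: T_def G_sym[of \<xi> Y] G_sym[of \<xi> Z])
qed simp_all

text \<open>As \<open>\<nabla>\<^sub>\<xi> \<xi> = 0\<close>, also
  \<open>\<nabla>\<^sub>\<xi> (\<phi>\<^sup>2) = 0\<close>; so \<open>\<phi>\<close> anticommutes
  with \<open>\<nabla>\<^sub>\<xi> \<phi>\<close>, which is \<open>\<phi> h\<close>.\<close>

lemma PHP [simp]:
  assumes [simp]: "Y \<in> VF"
  shows "P (H (P Y)) = H Y"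
proof -
  have "F \<xi> (P Y) + P (F \<xi> Y) = N \<xi> (P (P Y)) - P (P (N \<xi> Y))"
    by (simp add: F_def del: P_P)
  also have "\<dots> = 0" by (simp add: act_G)
  finally have "P (H (P Y)) + P (P (H Y)) = 0" by (simp add: F_xi_left del: P_P)
  then show ?thesis by simp
qed

lemma PH:
  assumes [simp]: "Y \<in> VF"
  shows "P (H Y) = - H (P Y)"
proof -
  have "P (P (H (P Y))) = - H (P Y)" by (simp del: PHP)
  then show ?thesis by (simp del: P_P)
qed

text \<open>Evaluate \<open>g (\<phi> h X) (\<phi> Y)\<close> once by skewness of
  \<open>\<phi> h\<close> and once by skewness of \<open>\<phi>\<close>.\<close>

lemma H_skew:
  assumes [simp]: "X \<in> VF" "Y \<in> VF"
  shows "G (H X) Y p = - G X (H Y) p"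
proof -
  have "G (P (H X)) (P Y) p = - G (P (H (P Y))) X p" by (rule PH_skew') simp_all
  moreover have "G (P (H X)) (P Y) p = - G (H X) (P (P Y)) p" by (rule G_P) simp_all
  ultimately show ?thesis by (simp add: G_sym[of X])
qed

lemma PH_skew: "X \<in> VF \<Longrightarrow> Y \<in> VF \<Longrightarrow> G (P (H X)) Y p = - G X (P (H Y)) p"
  using PH_skew'[of X Y p] G_sym[of X "P (H Y)"] by simp

lemma A_skew: "X \<in> VF \<Longrightarrow> Y \<in> VF \<Longrightarrow> G (- P X + H X) Y p = - G X (- P Y + H Y) p"
  using G_P[of X Y p] H_skew[of X Y p] by simp

subsubsection \<open>The flow of the Killing field\<close>

lemma xi_killing:
  assumes [simp]: "Y \<in> VF" "Z \<in> VF"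
  shows "act \<xi> (G Y Z) = G (br \<xi> Y) Z + G Y (br \<xi> Z)"
proof
  fix p
  show "act \<xi> (G Y Z) p = (G (br \<xi> Y) Z + G Y (br \<xi> Z)) p"
    using A_skew[of Y Z p] by (simp add: act_G br_def)
qed

text \<open>The Lie derivative of the connection is symmetric by the Jacobi identity and takes values in
  skew operators since \<open>\<xi>\<close> is Killing; a tensor with both properties vanishes.\<close>

lemma br_xi_nabla:
  assumes X: "X \<in> VF" and Y: "Y \<in> VF"
  shows "br \<xi> (N X Y) = N (br \<xi> X) Y + N X (br \<xi> Y)"
proof -
  define K where "K X Y = br \<xi> (N X Y) - N (br \<xi> X) Y - N X (br \<xi> Y)" for X Y
  have [simp]: "K X Y \<in> VF" if "X \<in> VF" "Y \<in> VF" for X Y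
    using that by (simp add: K_def)
  have br_diff: "br \<xi> (V - W) = br \<xi> V - br \<xi> W" if "V \<in> VF" "W \<in> VF" for V W
    using that by (simp add: br_def)
  have sym: "K X Y = K Y X" if [simp]: "X \<in> VF" "Y \<in> VF" for X Y
  proof -
    have "K X Y - K Y X = br \<xi> (br X Y) - br (br \<xi> X) Y - br X (br \<xi> Y)"
      unfolding K_def br_def[of X Y] br_def[of "br \<xi> X" Y] br_def[of X "br \<xi> Y"]
      by (simp add: br_diff)
    then show ?thesis by (simp add: jacobi[of \<xi> X Y])
  qed
  have skew: "G (K X Y) Z p = - G (K X Z) Y p" if [simp]: "X \<in> VF" "Y \<in> VF" "Z \<in> VF" for X Y Z p
  proof -
    have "act (br \<xi> X) (G Y Z) p = act \<xi> (act X (G Y Z)) p - act X (act \<xi> (G Y Z)) p"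
      by (simp add: act_br)
    then have "G (K X Y) Z p + G Y (K X Z) p = 0"
      by (simp add: xi_killing act_rules act_G[of X] act_G[of "br \<xi> X"] K_def)
    then show ?thesis
      using G_sym[of Y "K X Z"] by simp
  qed
  show ?thesis
  proof -
    have "K X Y = 0"
    proof (rule G_eqI)
      fix Z p assume Z: "Z \<in> VF"
      \<comment> \<open>Alternate the two symmetries: six swaps return to the starting order, and
        the three skew ones contribute the sign.\<close>
      have "G (K X Y) Z p = - G (K X Y) Z p"
        using skew[of X Y Z p] skew[of Z X Y p] skew[of Y Z X p] sym[of X Y] sym[of X Z] sym[of Y Z] X Y Z
        by simp
      then show "G (K X Y) Z p = G 0 Z p" using Z by simp
    qed (use X Y in simp_all)
    then show ?thesis by (simp add: K_def algebra_simps)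
  qed
qed

section \<open>Covariant derivatives of \<open>\<phi> h\<close> and \<open>h\<close>\<close>

definition Q :: "'a vfield \<Rightarrow> 'a vfield \<Rightarrow> 'a vfield"
  where "Q X Y = N X (P (H Y)) - P (H (N X Y))"

lemma Q_VF [simp]: "X \<in> VF \<Longrightarrow> Y \<in> VF \<Longrightarrow> Q X Y \<in> VF"
  by (simp add: Q_def)

lemma br_xi_rules:
  "Y \<in> VF \<Longrightarrow> Z \<in> VF \<Longrightarrow> br \<xi> (Y + Z) = br \<xi> Y + br \<xi> Z"
  "Y \<in> VF \<Longrightarrow> Z \<in> VF \<Longrightarrow> br \<xi> (Y - Z) = br \<xi> Y - br \<xi> Z"
  "f \<in> SF \<Longrightarrow> Y \<in> VF \<Longrightarrow> br \<xi> (fmult f Y) = fmult (act \<xi> f) Y + fmult f (br \<xi> Y)"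
  "br \<xi> \<xi> = 0"
  by (simp_all add: br_def) (simp_all add: fmult_def fun_eq_iff algebra_simps scaleR_fun_def)

text \<open>The Lie derivative of \<open>\<phi>\<close> is
  \<open>\<nabla>\<^sub>\<xi> \<phi> - A \<phi> + \<phi> A\<close>. The first term is
  \<open>\<phi> h\<close>; in the commutator the \<open>\<phi>\<close> part of \<open>A\<close>
  cancels and the \<open>h\<close> part gives \<open>2 \<phi> h\<close> by anticommutation.\<close>

lemma br_xi_P:
  assumes [simp]: "Y \<in> VF"
  shows "br \<xi> (P Y) = P (br \<xi> Y) + fmult (\<lambda>p. 3) (P (H Y))"
proof -
  have "N \<xi> (P Y) = P (N \<xi> Y) + P (H Y)"
    using F_xi_left[of Y] by (metis F_def assms diff_add_cancel add.commute)
  then have "br \<xi> (P Y) = (P (N \<xi> Y) + P (H Y)) - (- P (P Y) - P (H Y))"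
    by (simp add: br_def PH del: P_P)
  moreover have "P (br \<xi> Y) = P (N \<xi> Y) - (- P (P Y) + P (H Y))"
    by (simp add: br_def del: P_P)
  ultimately show ?thesis
    by (simp add: fun_eq_iff fmult_def scaleR_fun_def del: P_P)
qed

lemma fmult_const_eq_0: "c \<noteq> 0 \<Longrightarrow> fmult (\<lambda>p. c) V = 0 \<Longrightarrow> V = 0"
  by (simp add: fmult_def fun_eq_iff scaleR_fun_def)

lemma Q_alt12:
  assumes [simp]: "X \<in> VF" "Y \<in> VF"
  shows "Q Y X = - Q X Y"
proof -
  \<comment> \<open>The Lie derivative commutes with \<open>\<nabla>\<close>, so besides the
    arguments it hits only \<open>\<phi>\<close>, and the derivative of \<open>3 \<phi> h\<close> is
    \<open>3 Q\<close>.\<close>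
  have brF: "br \<xi> (F X Y) = F (br \<xi> X) Y + F X (br \<xi> Y) + fmult (\<lambda>p. 3) (Q X Y)"
    if [simp]: "X \<in> VF" "Y \<in> VF" for X Y
    by (simp add: F_def Q_def br_xi_rules br_xi_nabla br_xi_P act_rules del: P_P PHP; simp add: fun_eq_iff fmult_def scaleR_fun_def)
  define R where "R X Y = fmult (G X Y + G X Y) \<xi> - fmult (G X \<xi>) Y - fmult (G Y \<xi>) X" for X Y
  have FR: "F X Y + F Y X = R X Y" if "X \<in> VF" "Y \<in> VF" for X Y
    using that by (simp add: R_def F_nearly_sasakian)
  \<comment> \<open>\<open>R\<close> is built from \<open>g\<close>, \<open>\<eta>\<close> and
    \<open>\<xi>\<close>, all invariant under the flow, so only the arguments are
    differentiated.\<close>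
  have "br \<xi> (R X Y) = R (br \<xi> X) Y + R X (br \<xi> Y)"
    by (simp add: R_def br_xi_rules xi_killing act_rules act_double)
       (simp add: fmult_def fun_eq_iff algebra_simps scaleR_fun_def)
  moreover have "br \<xi> (F X Y + F Y X) = (F (br \<xi> X) Y + F Y (br \<xi> X)) + (F X (br \<xi> Y) + F (br \<xi> Y) X) +
      fmult (\<lambda>p. 3) (Q X Y + Q Y X)"
    by (simp add: br_xi_rules brF; simp add: fun_eq_iff fmult_def scaleR_fun_def)
  ultimately have "fmult (\<lambda>p. 3) (Q X Y + Q Y X) = 0"
    by (simp add: FR)
  then have "Q X Y + Q Y X = 0" by (rule fmult_const_eq_0[rotated]) simp
  then show ?thesis by (simp add: eq_neg_iff_add_eq_0 add.commute)
qed

lemma Q_skew: "X \<in> VF \<Longrightarrow> Y \<in> VF \<Longrightarrow> Z \<in> VF \<Longrightarrow> G (Q X Z) Y p = - G (Q X Y) Z p"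
  unfolding Q_def using skew_cov_deriv[of "\<lambda>X. P (H X)" X Y Z p] by (simp add: PH_skew)

definition DH :: "'a vfield \<Rightarrow> 'a vfield \<Rightarrow> 'a vfield"
  where "DH X Y = N X (H Y) - H (N X Y)"

lemma DH_VF [simp]: "X \<in> VF \<Longrightarrow> Y \<in> VF \<Longrightarrow> DH X Y \<in> VF"
  by (simp add: DH_def)

lemma DH_skew: "X \<in> VF \<Longrightarrow> Y \<in> VF \<Longrightarrow> Z \<in> VF \<Longrightarrow> G (DH X Z) Y p = - G (DH X Y) Z p"
  unfolding DH_def using skew_cov_deriv[of H X Y Z p] by (simp add: H_skew)

lemma Q_eq: "X \<in> VF \<Longrightarrow> Y \<in> VF \<Longrightarrow> Q X Y = F X (H Y) + P (DH X Y)"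
  by (simp add: Q_def F_def DH_def)

text \<open>Compute \<open>Q \<xi> Y\<close> by the product rule and, through skewness, as
  \<open>- Q Y \<xi>\<close>. The result equals \<open>\<nabla>\<^sub>\<xi> \<phi>\<close>, so
  \<open>A\<close> is parallel along \<open>\<xi>\<close>.\<close>

lemma DH_xi_left:
  assumes [simp]: "Y \<in> VF"
  shows "DH \<xi> Y = P (H Y)"
proof -
  have "Q \<xi> Y = - Q Y \<xi>" using Q_alt12[of Y \<xi>] by simp
  also have "Q Y \<xi> = H Y - P (H (H Y))" by (simp add: Q_def)
  finally have "P (H (H Y)) + P (DH \<xi> Y) = - (H Y - P (H (H Y)))"
    by (simp only: Q_eq F_xi_left assms xi_VF H_VF)
  moreover have "b = - c" if "a + b = - (c - a)" for a b c :: "'a vfield"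
    using that by (metis add_left_cancel diff_conv_add_uminus minus_diff_eq)
  ultimately have "P (DH \<xi> Y) = - H Y" by blast
  then have "P (P (DH \<xi> Y)) = - P (H Y)" by (simp del: P_P)
  moreover have "G (DH \<xi> Y) \<xi> = 0"
    using DH_skew[of \<xi> \<xi> Y] by (simp add: fun_eq_iff DH_def[of \<xi> \<xi>])
  ultimately show ?thesis by simp
qed

text \<open>This is \<open>dd\<eta> = 0\<close>, since \<open>d\<eta>\<close> is a multiple of the form \<open>w\<close> below.\<close>

lemma A_cyclic:
  assumes [simp]: "X \<in> VF" "Y \<in> VF" "Z \<in> VF"
  shows "G (DH X Y) Z p + G (DH Y Z) X p + G (DH Z X) Y p =
    G (F X Y) Z p + G (F Y Z) X p + G (F Z X) Y p"
proof -
  define w where "w X Y = G (- P X + H X) Y" for X Y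
  have w: "w Y Z + w Y Z = act Y (G Z \<xi>) - act Z (G Y \<xi>) - G (br Y Z) \<xi>"
    if [simp]: "Y \<in> VF" "Z \<in> VF" for Y Z
  proof
    fix p
    show "(w Y Z + w Y Z) p = (act Y (G Z \<xi>) - act Z (G Y \<xi>) - G (br Y Z) \<xi>) p"
      using A_skew[of Y Z p] by (simp add: w_def act_G br_def G_sym[of Z "P Y"] G_sym[of Z "H Y"])
  qed
  have w_skew: "w Y X p = - w X Y p" if [simp]: "X \<in> VF" "Y \<in> VF" for X Y
    using A_skew[of Y X p] by (simp add: w_def G_sym[of Y])
  have w_SF [simp]: "w X Y \<in> SF" if "X \<in> VF" "Y \<in> VF" for X Y
    using that by (simp add: w_def del: G_fun)
  have act_w: "2 * act X (w Y Z) p = act X (act Y (G Z \<xi>)) p - act X (act Z (G Y \<xi>)) p - act X (G (br Y Z) \<xi>) p"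
    if [simp]: "X \<in> VF" "Y \<in> VF" "Z \<in> VF" for X Y Z
  proof -
    have "act X (w Y Z + w Y Z) p = act X (act Y (G Z \<xi>) - act Z (G Y \<xi>) - G (br Y Z) \<xi>) p"
      by (simp only: w that)
    then show ?thesis by (simp add: act_rules act_double)
  qed
  have w_br: "2 * w (br X Y) Z p = act X (act Y (G Z \<xi>)) p - act Y (act X (G Z \<xi>)) p
      - act Z (G (br X Y) \<xi>) p - G (br (br X Y) Z) \<xi> p"
    if [simp]: "X \<in> VF" "Y \<in> VF" "Z \<in> VF" for X Y Z
    using fun_cong[OF w[of "br X Y" Z], of p] by (simp add: act_br)
  \<comment> \<open>The left side is \<open>g ((\<nabla>\<^sub>X A) Y) Z\<close> with
    \<open>A = - \<phi> + h\<close>; its cyclic sum is the exterior derivative of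
    \<open>w\<close>.\<close>
  have dA: "G (DH X Y) Z p - G (F X Y) Z p = act X (w Y Z) p - w (N X Y) Z p + w (N X Z) Y p"
    if [simp]: "X \<in> VF" "Y \<in> VF" "Z \<in> VF" for X Y Z
  proof -
    have "act X (w Y Z) = G (N X (- P Y + H Y)) Z + G (- P Y + H Y) (N X Z)"
      unfolding w_def by (rule act_G) simp_all
    moreover have "w (N X Z) Y p = - G (- P Y + H Y) (N X Z) p"
      using w_skew[of "N X Z" Y] by (simp add: w_def)
    ultimately show ?thesis
      by (simp add: DH_def F_def w_def)
  qed
  have w_diff: "w (br X Y) Z p = w (N X Y) Z p - w (N Y X) Z p" if [simp]: "X \<in> VF" "Y \<in> VF" "Z \<in> VF" for X Y Z
    by (simp add: br_def w_def)
  have "br (br X Y) Z + br (br Y Z) X + br (br Z X) Y = 0"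
  proof -
    have *: "br V W = - br W V" for V W by (simp add: br_def)
    have "br Y (br X Z) = br (br Z X) Y"
      using *[of X Z] *[of Y "br X Z"] by (simp add: br_def)
    then have "br (br X Y) Z + br (br Z X) Y = - br (br Y Z) X"
      using jacobi[of X Y Z] *[of X "br Y Z"] by simp
    moreover have "a + b + c = 0" if "a + c = - b" for a b c :: "'a vfield"
      using that by (metis add.commute add.left_commute add.right_inverse)
    ultimately show ?thesis by blast
  qed
  then have "G (br (br X Y) Z + br (br Y Z) X + br (br Z X) Y) \<xi> p = 0" by simp
  then have j: "G (br (br X Y) Z) \<xi> p + G (br (br Y Z) X) \<xi> p + G (br (br Z X) Y) \<xi> p = 0" by simp
  \<comment> \<open>In the cyclic sum the second derivatives of \<open>\<eta>\<close> cancel in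
    pairs, and \<open>j\<close>, the Jacobi identity, removes the iterated brackets.\<close>
  show ?thesis
    using dA[of X Y Z] dA[of Y Z X] dA[of Z X Y] w_diff[of X Y Z] w_diff[of Y Z X] w_diff[of Z X Y]
      w_br[of X Y Z] w_br[of Y Z X] w_br[of Z X Y] j act_w[of X Y Z] act_w[of Y Z X] act_w[of Z X Y]
    by simp
qed

subsubsection \<open>The modified connection\<close>

definition horiz :: "'a vfield set"
  where "horiz = {X \<in> VF. G X \<xi> = 0}"

lemma horizI: "X \<in> VF \<Longrightarrow> G X \<xi> = 0 \<Longrightarrow> X \<in> horiz"
  by (simp add: horiz_def)

lemma horizD: "X \<in> horiz \<Longrightarrow> X \<in> VF" "X \<in> horiz \<Longrightarrow> G X \<xi> = 0"
  by (auto simp: horiz_def)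

text \<open>The second conclusion replaces \<open>\<nabla>h\<close> by \<open>T\<close> on
  horizontal fields; the first then makes \<open>T\<close> vanish as soon as one argument is in the
  image of \<open>h\<close>.\<close>

lemma DH_horizontal:
  assumes "X \<in> horiz" "Y \<in> horiz" "Z \<in> horiz"
  shows "T (H X) Y Z p = 0" and "G (DH X Y) Z p = T X Y Z p"
proof -
  have TF: "T X Y Z p = G (F X Y) Z p" if "X \<in> horiz" "Y \<in> horiz" "Z \<in> horiz" for X Y Z
    using that[THEN horizD(1)] that[THEN horizD(2)] by (simp add: T_def)
  \<comment> \<open>Take the covariant derivative of
    \<open>\<phi>\<^sup>2 = - I + \<eta> \<otimes> \<xi>\<close>; on a horizontal \<open>Y\<close>
    it is a multiple of \<open>\<xi>\<close> and pairs to 0 with \<open>Z\<close>.\<close>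
  have TP: "T X (P Y) Z p = T X Y (P Z) p" if X: "X \<in> horiz" and Y: "Y \<in> horiz" and Z: "Z \<in> horiz" for X Y Z
  proof -
    note [simp] = horizD[OF X] horizD[OF Y] horizD[OF Z]
    have "F X (P Y) + P (F X Y) = N X (P (P Y)) - P (P (N X Y))"
      by (simp add: F_def del: P_P)
    then have "G (F X (P Y) + P (F X Y)) Z p = G (N X (P (P Y)) - P (P (N X Y))) Z p" by simp
    then show ?thesis
      by (simp add: T_def G_P G_sym[of \<xi> Z])
  qed
  have closed: "P X \<in> horiz" "H X \<in> horiz" if "X \<in> horiz" for X
    using horizD[OF that] by (auto intro!: horizI)
  have PP: "P (P X) = - X" if "X \<in> horiz" for X
    using horizD[OF that] by simp
  have QG: "G (Q X Y) Z p = T X (H Y) Z p - G (DH X Y) (P Z) p"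
    if "X \<in> horiz" "Y \<in> horiz" "Z \<in> horiz" for X Y Z
    using that[THEN horizD(1)] that[THEN horizD(2)] by (simp add: Q_eq T_def G_P)
  have cyc: "G (DH X Y) Z p + G (DH Y Z) X p + G (DH Z X) Y p = 3 * T X Y Z p"
    if h: "X \<in> horiz" "Y \<in> horiz" "Z \<in> horiz" for X Y Z
  proof -
    have "T Y Z X p = T X Y Z p" "T Z X Y p = T X Y Z p"
      using h[THEN horizD(1)] T_alt12[of X Y Z p] T_alt23[of Y X Z p] T_alt23[of X Z Y p] T_alt12[of X Z Y p] by simp_all
    then show ?thesis using A_cyclic[of X Y Z p] TF h h[THEN horizD(1)] by simp
  qed
  note * = three_form_vanishing[of horiz P H "\<lambda>X Y Z. T X Y Z p" "\<lambda>X Y Z. G (Q X Y) Z p" "\<lambda>X Y Z. G (DH X Y) Z p" X Y Z]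
  have fhf: "P (H (P X)) = H X" if "X \<in> horiz" for X using horizD[OF that] by simp
  have Qm: "G (Q Y X) Z p = - G (Q X Y) Z p" if "X \<in> horiz" "Y \<in> horiz" "Z \<in> horiz" for X Y Z
    using that[THEN horizD(1)] Q_alt12[of X Y] by simp
  show "T (H X) Y Z p = 0"
    by (rule *(1); (rule closed | rule T_alt12 T_alt23 Qm Q_skew DH_skew cyc TP PP QG fhf | rule assms)?;
        (assumption | rule horizD(1))?; (assumption | simp add: T_def horizD)?)
  show "G (DH X Y) Z p = T X Y Z p"
    by (rule *(2); (rule closed | rule T_alt12 T_alt23 Qm Q_skew DH_skew cyc TP PP QG fhf | rule assms)?;
        (assumption | rule horizD(1))?; (assumption | simp add: T_def horizD)?)
qed

definition Ax :: "'a vfield \<Rightarrow> 'a vfield"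
  where "Ax X = - P X + H X"

definition D :: "'a vfield \<Rightarrow> 'a vfield \<Rightarrow> 'a vfield"
  where "D X Y = N X Y + fmult (G (Ax X) Y) \<xi> - fmult (G Y \<xi>) (Ax X)"

lemma Ax_VF [simp]: "X \<in> VF \<Longrightarrow> Ax X \<in> VF"
  by (simp add: Ax_def)

lemma D_VF [simp]: "X \<in> VF \<Longrightarrow> Y \<in> VF \<Longrightarrow> D X Y \<in> VF"
  by (simp add: D_def)

text \<open>The correction \<open>g (A X) Y \<xi> - \<eta> Y A X\<close> is a skew operator in
  \<open>Y\<close>, so its contributions to the two summands cancel.\<close>

lemma D_metric:
  assumes [simp]: "X \<in> VF" "Y \<in> VF" "Z \<in> VF"
  shows "act X (G Y Z) p = G (D X Y) Z p + G Y (D X Z) p"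
  using G_sym[of \<xi> Z] G_sym[of Y "Ax X"] by (simp add: act_G D_def)

text \<open>The constant \<open>c\<close> will be the eigenvalue: \<open>D\<close> then commutes
  with \<open>h\<^sup>2 - \<mu>\<close> once it commutes with \<open>h\<^sup>2\<close>.\<close>

lemma D_linear:
  assumes [simp]: "X \<in> VF" "Y \<in> VF" "Z \<in> VF"
  shows "D X (Y - fmult (\<lambda>p. c) Z) = D X Y - fmult (\<lambda>p. c) (D X Z)"
  by (rule G_eqI) (simp_all add: D_def act_rules algebra_simps)

text \<open>The summand \<open>\<nabla>h\<^sup>2\<close> vanishes on triples of horizontal fields by \<open>three_form_vanishing\<close>; the correction
  terms in \<open>D\<close> make \<open>\<xi>\<close> parallel and so account for the remaining components.\<close>

lemma D_HH:
  assumes X: "X \<in> VF" and Y: "Y \<in> VF"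
  shows "D X (H (H Y)) = H (H (D X Y))"
proof -
  define E where "E X Y = N X (H (H Y)) - H (H (N X Y))" for X Y
  have E_VF [simp]: "E X Y \<in> VF" if "X \<in> VF" "Y \<in> VF" for X Y using that by (simp add: E_def)
  have E_DH: "E X Y = DH X (H Y) + H (DH X Y)" if "X \<in> VF" "Y \<in> VF" for X Y
    using that by (simp add: E_def DH_def)
  have E_horiz: "G (E X Y) Z p = 0" if h: "X \<in> horiz" "Y \<in> horiz" "Z \<in> horiz" for X Y Z p
  proof -
    note [simp] = h[THEN horizD(1)] h[THEN horizD(2)]
    have H: "H Y \<in> horiz" "H Z \<in> horiz" by (auto intro!: horizI)
    \<comment> \<open>Product rule for \<open>h\<^sup>2\<close>, with the outer \<open>h\<close>
      moved onto \<open>Z\<close> by skewness; each term now has an argument in the image of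
      \<open>h\<close>.\<close>
    have "G (E X Y) Z p = T X (H Y) Z p - T X Y (H Z) p"
      using DH_horizontal(2)[OF h(1) H(1) h(3), of p] DH_horizontal(2)[OF h(1) h(2) H(2), of p]
      by (simp add: E_DH H_skew)
    moreover have "T X (H Y) Z p = 0"
      using T_alt12[of "H Y" X Z p] DH_horizontal(1)[OF h(2,1,3)] by simp
    moreover have "T X Y (H Z) p = 0"
      using T_alt23[of X "H Z" Y p] T_alt12[of "H Z" X Y p] DH_horizontal(1)[OF h(3,1,2)] by simp
    ultimately show ?thesis by simp
  qed
  \<comment> \<open>The product rule gives \<open>\<phi> h h + h \<phi> h\<close>, which is 0 by
    anticommutation.\<close>
  have E_xi: "E \<xi> Y = 0" if [simp]: "Y \<in> VF" for Y
    by (simp add: E_DH DH_xi_left PH)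
  define hor where "hor X = X - fmult (G X \<xi>) \<xi>" for X
  have hor: "hor X \<in> horiz" "X = hor X + fmult (G X \<xi>) \<xi>" if "X \<in> VF" for X
    using that by (auto simp: hor_def fun_eq_iff intro!: horizI)
  have E_left: "E (X + fmult f Z) Y = E X Y + fmult f (E Z Y)"
    and E_right: "E X (Y + fmult f Z) = E X Y + fmult f (E X Z)"
    if [simp]: "X \<in> VF" "Y \<in> VF" "Z \<in> VF" "f \<in> SF" for X Y Z f
    by (rule G_eqI; simp add: E_def algebra_simps)+
  have E1: "E X Y = E (hor X) Y" if [simp]: "X \<in> VF" "Y \<in> VF" for X Y
  proof -
    have "E X Y = E (hor X) Y + fmult (G X \<xi>) (E \<xi> Y)"
      using E_left[OF horizD(1)[OF hor(1)], of X Y \<xi> "G X \<xi>"] hor(2)[of X] by simp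
    then show ?thesis by (simp add: E_xi)
  qed
  have E2: "E X Y = E X (hor Y) - fmult (G Y \<xi>) (H (H (Ax X)))" if [simp]: "X \<in> VF" "Y \<in> VF" for X Y
  proof -
    have "E X Y = E X (hor Y) + fmult (G Y \<xi>) (E X \<xi>)"
      using E_right[OF _ horizD(1)[OF hor(1)], of X Y \<xi> "G Y \<xi>"] hor(2)[of Y] by simp
    moreover have "E X \<xi> = - H (H (Ax X))" by (simp add: E_def Ax_def)
    ultimately show ?thesis by (simp add: fmult_def fun_eq_iff)
  qed
  note [simp] = X Y
  \<comment> \<open>This is \<open>(D\<^sub>X h\<^sup>2) Y\<close> written out; the two other
    correction terms drop out because \<open>h \<xi> = 0\<close> and
    \<open>\<eta> (h\<^sup>2 Y) = 0\<close>.\<close>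
  let ?W = "E X Y + fmult (G (Ax X) (H (H Y))) \<xi> + fmult (G Y \<xi>) (H (H (Ax X)))"
  have "?W = 0"
  proof (rule G_eqI)
    fix Z p assume Z [simp]: "Z \<in> VF"
    note [simp] = horizD[OF hor(1)]
    have dec: "G V Z p = G V (hor Z) p + G Z \<xi> p * G V \<xi> p" if "V \<in> VF" for V
      using that by (simp add: hor_def)
    have W: "?W = E X (hor Y) + fmult (G (Ax X) (H (H Y))) \<xi>"
      by (simp add: E2)
    have "G (E X (hor Y)) (hor Z) p = 0"
      using E_horiz[OF hor(1) hor(1) hor(1)] by (simp add: E1[of X])
    then have W1: "G ?W (hor Z) p = 0"
      unfolding W using G_sym[of \<xi> "hor Z"] by simp
    \<comment> \<open>Differentiating \<open>g (h\<^sup>2 Y) \<xi> = 0\<close> shows that the second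
      summand of \<open>?W\<close> compensates the \<open>\<xi>\<close>-component of
      \<open>\<nabla>h\<^sup>2\<close>.\<close>
    have W2: "G ?W \<xi> p = 0"
    proof -
      have HH: "H (H (hor Y)) = H (H Y)" by (simp add: hor_def)
      have "act X (G (H (H Y)) \<xi>) p = 0" by (simp add: act_rules)
      then have "G (N X (H (H Y))) \<xi> p + G (H (H Y)) (Ax X) p = 0"
        by (simp add: act_G Ax_def del: G_xi_zero)
      then show ?thesis
        unfolding W using G_sym[of "Ax X" "H (H Y)"] by (simp add: E_def HH)
    qed
    have "G ?W Z p = G ?W (hor Z) p + G Z \<xi> p * G ?W \<xi> p"
      by (rule dec) simp
    then show "G ?W Z p = G 0 Z p"
      unfolding W1 W2 G_rules(9)[OF Z] by simp
  qed simp_all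
  moreover have "D X (H (H Y)) - H (H (D X Y)) = ?W"
    by (simp add: D_def E_def)
  ultimately show ?thesis by (simp del: D_VF)
qed

end

subsection \<open>Linear ordinary differential equations\<close>

text \<open>Weighting the solution with \<open>exp (- k * t)\<close> turns the Volterra operator into a contraction.\<close>

lemma linear_ode_solution:
  fixes W :: "real \<Rightarrow> 'e::euclidean_space \<Rightarrow> 'e"
  assumes lin: "\<And>t. t \<in> {0..1} \<Longrightarrow> linear (W t)"
    and cont: "\<And>v. continuous_on {0..1} (\<lambda>t. W t v)"
  shows "\<exists>a. a 0 = a0 \<and> (\<forall>t\<in>{0..1}. (a has_vector_derivative W t (a t)) (at t within {0..1}))"
proof -
  have W_eq: "W t v = (\<Sum>b\<in>Basis. (v \<bullet> b) *\<^sub>R W t b)" if "t \<in> {0..1}" for t v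
  proof -
    have "W t v = W t (\<Sum>b\<in>Basis. (v \<bullet> b) *\<^sub>R b)" by (simp add: euclidean_representation)
    then show ?thesis by (simp add: linear_sum[OF lin[OF that]] linear_scale[OF lin[OF that]])
  qed
  have W_cont: "continuous_on {0..1} (\<lambda>t. W t (u t))" if "continuous_on {0..1} u" for u
  proof -
    have "continuous_on {0..1} (\<lambda>t. \<Sum>b\<in>Basis. (u t \<bullet> b) *\<^sub>R W t b)"
      by (intro continuous_intros that cont)
    then show ?thesis by (rule continuous_on_eq) (rule W_eq[symmetric])
  qed
  have "\<exists>C. \<forall>t\<in>{0..1}. norm (W t b) \<le> C" for b
    using compact_imp_bounded[OF compact_continuous_image[OF cont[of b] compact_Icc]]
    by (auto simp: bounded_iff)
  then obtain C where C: "norm (W t b) \<le> C b" if "t \<in> {0..1}" for t b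
    by metis
  define M where "M = (\<Sum>b\<in>Basis. \<bar>C b\<bar>) + 1"
  have M: "M > 0" by (auto simp: M_def intro!: add_nonneg_pos sum_nonneg)
  have W_bound: "norm (W t v) \<le> M * norm v" if t: "t \<in> {0..1}" for t v
  proof -
    have "norm (W t v) \<le> (\<Sum>b\<in>Basis. norm ((v \<bullet> b) *\<^sub>R W t b))"
      unfolding W_eq[OF t, of v] by (rule norm_sum)
    also have "\<dots> \<le> (\<Sum>b\<in>Basis. norm v * \<bar>C b\<bar>)"
    proof (rule sum_mono)
      fix b :: 'e assume "b \<in> Basis"
      then show "norm ((v \<bullet> b) *\<^sub>R W t b) \<le> norm v * \<bar>C b\<bar>"
        using C[OF t, of b] by (auto intro!: mult_mono Basis_le_norm)
    qed
    also have "\<dots> \<le> M * norm v"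
      by (simp add: M_def sum_distrib_left[symmetric] algebra_simps)
    finally show ?thesis .
  qed
  \<comment> \<open>Chosen so that the Lipschitz constant \<open>M / k\<close> is 1/2.\<close>
  define k where "k = 2 * M"
  have k: "k > 0" using M by (simp add: k_def)
  \<comment> \<open>A fixed point \<open>u\<close> is the weighted solution
    \<open>exp (- k * t) a t\<close>: by linearity the integrand
    \<open>exp (k * s) W s (u s)\<close> is \<open>W s (a s)\<close>.\<close>
  define I where "I u t = exp (- k * t) *\<^sub>R (a0 + integral {0..t} (\<lambda>s. exp (k * s) *\<^sub>R W s (u s)))" for u t
  have E_cont: "continuous_on {0..1} (\<lambda>s. exp (k * s) *\<^sub>R W s (u s))" if "continuous_on {0..1} u" for u
    by (intro continuous_intros W_cont that)
  have I_cont: "continuous_on {0..1} (I u)" if "continuous_on {0..1} u" for u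
    unfolding I_def
    by (intro continuous_intros indefinite_integral_continuous_1 integrable_continuous_real E_cont that)
  \<comment> \<open>Clamping the parameter to \<open>{0..1}\<close> places the iteration in the
    complete space of bounded continuous functions on the line.\<close>
  define cl :: "real \<Rightarrow> real" where "cl t = max 0 (min 1 t)" for t
  have cl: "cl t \<in> {0..1}" "t \<in> {0..1} \<Longrightarrow> cl t = t" for t by (auto simp: cl_def)
  have cl_cont: "continuous_on UNIV cl" unfolding cl_def by (intro continuous_intros)
  have bc: "(\<lambda>t. I u (cl t)) \<in> bcontfun" if "continuous_on {0..1} u" for u
  proof -
    have "bounded (I u ` {0..1})"
      by (intro compact_imp_bounded compact_continuous_image I_cont that compact_Icc)
    then have "bounded (range (\<lambda>t. I u (cl t)))"
      by (rule bounded_subset) (use cl in auto)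
    moreover have "continuous_on UNIV (\<lambda>t. I u (cl t))"
      by (rule continuous_on_compose2[OF I_cont[OF that] cl_cont]) (use cl in auto)
    ultimately show ?thesis by (simp add: bcontfun_def)
  qed
  define S where "S u = Bcontfun (\<lambda>t. I (apply_bcontfun u) (cl t))" for u
  have S: "apply_bcontfun (S u) t = I (apply_bcontfun u) (cl t)" for u t
    unfolding S_def by (subst Bcontfun_inverse) (auto intro!: bc)
  have "\<exists>!u. S u = u"
  proof (rule banach_fix_type[of "1/2"])
    show "\<forall>u v. dist (S u) (S v) \<le> 1 / 2 * dist u v"
    proof (intro allI dist_bound)
      fix u v :: "real \<Rightarrow>\<^sub>C 'e" and t0 :: real
      define t where "t = cl t0"
      have t: "t \<in> {0..1}" using cl by (simp add: t_def)
      define d where "d = dist u v"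
      let ?u = "apply_bcontfun u" and ?v = "apply_bcontfun v"
      have int: "(\<lambda>s. exp (k * s) *\<^sub>R W s (apply_bcontfun w s)) integrable_on {0..t}" for w
        by (intro integrable_continuous_real continuous_on_subset[OF E_cont]) (use t in auto)
      have exp_int: "((\<lambda>s. exp (k * s) * (M * d)) has_integral (exp (k * t) * (M * d / k) - exp (k * 0) * (M * d / k))) {0..t}"
      proof (rule fundamental_theorem_of_calculus)
        fix s
        show "((\<lambda>s. exp (k * s) * (M * d / k)) has_vector_derivative exp (k * s) * (M * d)) (at s within {0..t})"
          unfolding has_real_derivative_iff_has_vector_derivative[symmetric]
          using k by (auto intro!: derivative_eq_intros)
      qed (use t in auto)
      have "norm (integral {0..t} (\<lambda>s. exp (k * s) *\<^sub>R W s (?u s)) - integral {0..t} (\<lambda>s. exp (k * s) *\<^sub>R W s (?v s)))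
          = norm (integral {0..t} (\<lambda>s. exp (k * s) *\<^sub>R W s (?u s) - exp (k * s) *\<^sub>R W s (?v s)))"
        by (simp add: Henstock_Kurzweil_Integration.integral_diff int)
      also have "\<dots> \<le> integral {0..t} (\<lambda>s. exp (k * s) * (M * d))"
      proof (rule integral_norm_bound_integral)
        show "(\<lambda>s. exp (k * s) *\<^sub>R W s (?u s) - exp (k * s) *\<^sub>R W s (?v s)) integrable_on {0..t}"
          by (intro integrable_diff int)
        show "(\<lambda>s. exp (k * s) * (M * d)) integrable_on {0..t}"
          using exp_int by (rule has_integral_integrable)
        fix s assume "s \<in> {0..t}"
        then have s: "s \<in> {0..1}" using t by auto
        have "norm (W s (?u s - ?v s)) \<le> M * norm (?u s - ?v s)" by (rule W_bound[OF s])
        also have "\<dots> \<le> M * d"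
          using M dist_bounded[of u s v] by (auto simp: d_def dist_norm[symmetric])
        finally show "norm (exp (k * s) *\<^sub>R W s (?u s) - exp (k * s) *\<^sub>R W s (?v s)) \<le> exp (k * s) * (M * d)"
          by (simp add: scaleR_diff_right[symmetric] linear_diff[OF lin[OF s], symmetric])
      qed
      also have "\<dots> = exp (k * t) * (M * d / k) - M * d / k"
        using integral_unique[OF exp_int] by (simp only: mult_zero_right exp_zero mult_1_left)
      also have "\<dots> \<le> exp (k * t) * (M * d / k)"
        using M k by (simp add: d_def)
      finally have *: "norm (integral {0..t} (\<lambda>s. exp (k * s) *\<^sub>R W s (?u s)) - integral {0..t} (\<lambda>s. exp (k * s) *\<^sub>R W s (?v s)))
          \<le> exp (k * t) * (d / 2)"
        using M by (simp add: k_def)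
      have "dist (I ?u t) (I ?v t) = exp (- k * t) *
          norm (integral {0..t} (\<lambda>s. exp (k * s) *\<^sub>R W s (?u s)) - integral {0..t} (\<lambda>s. exp (k * s) *\<^sub>R W s (?v s)))"
        by (simp add: I_def dist_norm scaleR_diff_right[symmetric])
      also have "\<dots> \<le> exp (- k * t) * (exp (k * t) * (d / 2))"
        by (intro mult_left_mono *) simp
      also have "\<dots> = d / 2"
        by (simp add: mult.assoc[symmetric] exp_add[symmetric])
      finally show "dist (apply_bcontfun (S u) t0) (apply_bcontfun (S v) t0) \<le> 1 / 2 * dist u v"
        by (simp add: S t_def d_def)
    qed
  qed auto
  then obtain u where "S u = u" by blast
  then have u: "apply_bcontfun u t = I (apply_bcontfun u) t" if "t \<in> {0..1}" for t
    using S[of u t] cl(2)[OF that] by simp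
  define f where "f = (\<lambda>s. exp (k * s) *\<^sub>R W s (apply_bcontfun u s))"
  define a where "a t = a0 + integral {0..t} f" for t
  have a: "a t = exp (k * t) *\<^sub>R apply_bcontfun u t" if "t \<in> {0..1}" for t
    unfolding u[OF that] I_def f_def[symmetric] a_def[symmetric] by (simp add: exp_add[symmetric])
  have f: "continuous_on {0..1} f"
    unfolding f_def by (rule E_cont) auto
  have "(a has_vector_derivative W t (a t)) (at t within {0..1})" if t: "t \<in> {0..1}" for t
  proof -
    have "(a has_vector_derivative 0 + f t) (at t within {0..1})"
      unfolding a_def by (intro has_vector_derivative_add integral_has_vector_derivative f t) auto
    then show ?thesis
      by (simp add: f_def a[OF t] linear_scale[OF lin[OF t]])
  qed
  moreover have "a 0 = a0" by (simp add: a_def)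
  ultimately show ?thesis by blast
qed

text \<open>Superposing solutions that start at basis vectors makes \<open>\<Phi> t\<close> linear
  by construction, without appeal to uniqueness of solutions.\<close>

lemma linear_ode_flow:
  fixes W :: "real \<Rightarrow> 'e::euclidean_space \<Rightarrow> 'e"
  assumes lin: "\<And>t. t \<in> {0..1} \<Longrightarrow> linear (W t)"
    and cont: "\<And>v. continuous_on {0..1} (\<lambda>t. W t v)"
  obtains \<Phi> where "\<And>t. linear (\<Phi> t)" "\<And>x. \<Phi> 0 x = x"
    "\<And>x t. t \<in> {0..1} \<Longrightarrow> ((\<lambda>t. \<Phi> t x) has_vector_derivative W t (\<Phi> t x)) (at t within {0..1})"
proof -
  obtain a where a: "\<And>b. a b 0 = b"
    "\<And>b t. t \<in> {0..1} \<Longrightarrow> (a b has_vector_derivative W t (a b t)) (at t within {0..1})"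
    using linear_ode_solution[of W, OF lin cont] by metis
  define \<Phi> where "\<Phi> t x = (\<Sum>b\<in>Basis. (x \<bullet> b) *\<^sub>R a b t)" for t x
  show ?thesis
  proof (rule that)
    show "linear (\<Phi> t)" for t
      unfolding \<Phi>_def
      by (rule linearI) (simp_all add: inner_add_left scaleR_left_distrib sum.distrib scaleR_right.sum)
    show "\<Phi> 0 x = x" for x
      by (simp add: \<Phi>_def a euclidean_representation)
    show "((\<lambda>t. \<Phi> t x) has_vector_derivative W t (\<Phi> t x)) (at t within {0..1})" if t: "t \<in> {0..1}" for x t
    proof -
      have "((\<lambda>t. \<Sum>b\<in>Basis. (x \<bullet> b) *\<^sub>R a b t) has_vector_derivative
          (\<Sum>b\<in>Basis. (x \<bullet> b) *\<^sub>R W t (a b t))) (at t within {0..1})"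
      proof (rule has_vector_derivative_sum)
        fix b :: 'e
        show "((\<lambda>t. (x \<bullet> b) *\<^sub>R a b t) has_vector_derivative (x \<bullet> b) *\<^sub>R W t (a b t)) (at t within {0..1})"
          using bounded_linear.has_vector_derivative[OF bounded_linear_scaleR_right a(2)[OF t]] .
      qed
      then show ?thesis
        by (simp add: \<Phi>_def linear_sum[OF lin[OF t]] linear_scale[OF lin[OF t]])
    qed
  qed
qed

subsection \<open>Parallel transport and eigenspaces\<close>

context nearly_sasakian_manifold
begin

lemma g_sum:
  assumes "\<And>i. i \<in> I \<Longrightarrow> w i \<in> TS p" "v \<in> TS p"
  shows "g p v (\<Sum>i\<in>I. k i *\<^sub>R w i) = (\<Sum>i\<in>I. k i * g p v (w i))"
    and "g p (\<Sum>i\<in>I. k i *\<^sub>R w i) v = (\<Sum>i\<in>I. k i * g p (w i) v)"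
    and "(\<Sum>i\<in>I. k i *\<^sub>R w i) \<in> TS p"
proof -
  have *: "(\<Sum>i\<in>J. k i *\<^sub>R w i) \<in> TS p" if "J \<subseteq> I" for J
    by (intro subspace_sum[OF subspace_tangent_space]) (use assms(1) that in auto)
  then show m: "(\<Sum>i\<in>I. k i *\<^sub>R w i) \<in> TS p" by auto
  show "g p v (\<Sum>i\<in>I. k i *\<^sub>R w i) = (\<Sum>i\<in>I. k i * g p v (w i))"
    using assms(1) *
  proof (induction I rule: infinite_finite_induct)
    case (insert i I)
    then have "(\<Sum>i\<in>I. k i *\<^sub>R w i) \<in> TS p" by blast
    moreover have "k i *\<^sub>R w i \<in> TS p" using insert.prems by simp
    moreover have "g p v (\<Sum>i\<in>I. k i *\<^sub>R w i) = (\<Sum>i\<in>I. k i * g p v (w i))"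
      using insert by blast
    ultimately have "g p v (k i *\<^sub>R w i + (\<Sum>i\<in>I. k i *\<^sub>R w i)) = k i * g p v (w i) + (\<Sum>i\<in>I. k i * g p v (w i))"
      using g_rules(1)[OF assms(2), of "k i *\<^sub>R w i" "\<Sum>i\<in>I. k i *\<^sub>R w i"]
        g_rules(2)[OF assms(2) insert.prems(1)[of i], of "k i"]
      by simp
    then show ?case
      by (intro trans[OF arg_cong[of _ _ "g p v", OF sum.insert[OF insert.hyps]]])
         (simp add: sum.insert[OF insert.hyps])
  qed (use assms(2) in \<open>simp_all add: g_rules\<close>)
  then show "g p (\<Sum>i\<in>I. k i *\<^sub>R w i) v = (\<Sum>i\<in>I. k i * g p (w i) v)"
    using g_sym[OF m assms(2)] g_sym[OF assms(1) assms(2)] by simp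
qed

text \<open>A section \<open>\<Sum>b. a b t * E b\<close> along an integral curve \<open>c\<close> of \<open>V\<close> which is parallel for \<open>D\<close> keeps its
  length, and so does its image under a parallel tensor; \<open>S b\<close> is the image of \<open>E b\<close>.\<close>

lemma parallel_section_norm:
  fixes a a' :: "'i \<Rightarrow> real \<Rightarrow> real"
  assumes V: "V \<in> VF" and S: "\<And>b. b \<in> B \<Longrightarrow> S b \<in> VF"
    and integral_curve: "\<And>f t. f \<in> SF \<Longrightarrow> t \<in> {0..1} \<Longrightarrow>
      ((\<lambda>t. f (c t)) has_real_derivative act V f (c t)) (at t within {0..1})"
    and a: "\<And>b t. b \<in> B \<Longrightarrow> t \<in> {0..1} \<Longrightarrow> (a b has_real_derivative a' b t) (at t within {0..1})"
    and parallel: "\<And>t. t \<in> {0..1} \<Longrightarrow>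
      (\<Sum>b\<in>B. a' b t *\<^sub>R S b (c t)) + (\<Sum>b\<in>B. a b t *\<^sub>R D V (S b) (c t)) = 0"
  shows "g (c 1) (\<Sum>b\<in>B. a b 1 *\<^sub>R S b (c 1)) (\<Sum>b\<in>B. a b 1 *\<^sub>R S b (c 1)) =
    g (c 0) (\<Sum>b\<in>B. a b 0 *\<^sub>R S b (c 0)) (\<Sum>b\<in>B. a b 0 *\<^sub>R S b (c 0))"
proof -
  define s where "s t = (\<Sum>b\<in>B. a b t *\<^sub>R S b (c t))" for t
  note TS = VF_tangent[OF S] VF_tangent[OF D_VF[OF V S]]
  have s_TS: "s t \<in> TS (c t)" for t
    unfolding s_def by (rule g_sum(3)[OF TS(1), where v = 0]) auto
  have expand: "g (c t) (s t) (s t) = (\<Sum>b\<in>B. \<Sum>d\<in>B. a b t * a d t * G (S b) (S d) (c t))" for t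
  proof -
    have "g (c t) (s t) (s t) = (\<Sum>b\<in>B. a b t * g (c t) (S b (c t)) (s t))"
      unfolding s_def[of t] using s_TS[of t, unfolded s_def] by (intro g_sum(2) TS)
    also have "\<dots> = (\<Sum>b\<in>B. a b t * (\<Sum>d\<in>B. a d t * g (c t) (S b (c t)) (S d (c t))))"
      unfolding s_def[of t] by (intro sum.cong refl arg_cong2[where f = "(*)"] g_sum(1) TS)
    finally show ?thesis by (simp add: G_def sum_distrib_left mult.assoc)
  qed
  have "((\<lambda>t. g (c t) (s t) (s t)) has_real_derivative 0) (at t within {0..1})" if t: "t \<in> {0..1}" for t
  proof -
    \<comment> \<open>The product rule produces \<open>?A b d + ?A d b\<close>. Summed over both
      indices, \<open>?A\<close> pairs the covariant derivative of the section, which is 0, with the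
      section itself.\<close>
    let ?A = "\<lambda>b d. a' b t * a d t * G (S b) (S d) (c t) + a b t * a d t * G (D V (S b)) (S d) (c t)"
    have "((\<lambda>t. \<Sum>b\<in>B. \<Sum>d\<in>B. a b t * a d t * G (S b) (S d) (c t)) has_real_derivative
       (\<Sum>b\<in>B. \<Sum>d\<in>B. ?A b d + ?A d b)) (at t within {0..1})"
    proof (intro DERIV_sum)
      fix b d assume bd: "b \<in> B" "d \<in> B"
      have "((\<lambda>t. G (S b) (S d) (c t)) has_real_derivative
          G (D V (S b)) (S d) (c t) + G (S b) (D V (S d)) (c t)) (at t within {0..1})"
        using integral_curve[OF G_SF[OF S[OF bd(1)] S[OF bd(2)]] t] D_metric[OF V S[OF bd(1)] S[OF bd(2)]] by simp
      note deriv = DERIV_mult[OF DERIV_mult[OF a[OF bd(1) t] a[OF bd(2) t]] this]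
      show "((\<lambda>t. a b t * a d t * G (S b) (S d) (c t)) has_real_derivative ?A b d + ?A d b) (at t within {0..1})"
        by (rule DERIV_cong[OF deriv])
           (simp add: G_sym[OF S[OF bd(1)] S[OF bd(2)]] G_sym[OF S[OF bd(1)] D_VF[OF V S[OF bd(2)]]] algebra_simps)
    qed
    moreover have "(\<Sum>b\<in>B. \<Sum>d\<in>B. ?A b d) = 0"
    proof -
      have "(\<Sum>b\<in>B. \<Sum>d\<in>B. ?A b d) = (\<Sum>b\<in>B. a' b t * (\<Sum>d\<in>B. a d t * G (S b) (S d) (c t)))
          + (\<Sum>b\<in>B. a b t * (\<Sum>d\<in>B. a d t * G (D V (S b)) (S d) (c t)))"
        by (simp add: sum.distrib sum_distrib_left mult.assoc)
      also have "\<dots> = (\<Sum>b\<in>B. a' b t * g (c t) (S b (c t)) (s t)) + (\<Sum>b\<in>B. a b t * g (c t) (D V (S b) (c t)) (s t))"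
        unfolding s_def G_def by (intro arg_cong2[where f = "(+)"] sum.cong refl arg_cong2[where f = "(*)"] g_sum(1)[symmetric] TS)
      also have "\<dots> = g (c t) (\<Sum>b\<in>B. a' b t *\<^sub>R S b (c t)) (s t) + g (c t) (\<Sum>b\<in>B. a b t *\<^sub>R D V (S b) (c t)) (s t)"
        by (intro arg_cong2[where f = "(+)"] g_sum(2)[symmetric] TS s_TS)
      also have "\<dots> = g (c t) ((\<Sum>b\<in>B. a' b t *\<^sub>R S b (c t)) + (\<Sum>b\<in>B. a b t *\<^sub>R D V (S b) (c t))) (s t)"
        by (rule g_rules(6)[OF s_TS g_sum(3)[OF TS(1) s_TS] g_sum(3)[OF TS(2) s_TS], symmetric])
      also have "\<dots> = 0" using parallel[OF t] s_TS by (simp add: g_rules)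
      finally show ?thesis .
    qed
    moreover have "(\<Sum>b\<in>B. \<Sum>d\<in>B. ?A d b) = (\<Sum>b\<in>B. \<Sum>d\<in>B. ?A b d)"
      by (rule sum.swap)
    ultimately show ?thesis unfolding expand by (simp only: sum.distrib add_0)
  qed
  moreover have "(*) (0::real) = (\<lambda>h. 0)" by auto
  ultimately obtain k where "\<forall>t\<in>{0..1}. g (c t) (s t) (s t) = k"
    using has_derivative_zero_constant[of "{0..1::real}" "\<lambda>t. g (c t) (s t) (s t)"]
    by (auto simp: has_field_derivative_def)
  then show ?thesis by (simp add: s_def)
qed

text \<open>The two points enter symmetrically, so exchanging them yields equality. Convexity keeps
  the segment between them in the ball, where the cut-off fields are genuine coordinate
  fields.\<close>

lemma dim_eigenspace_le:
  assumes Uc: "(U, c) \<in> A" and sub: "ball z r \<subseteq> c ` U"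
    and X: "\<And>v. X v \<in> VF" and y: "\<And>e. y e \<in> SF"
    and X_eq: "\<And>q v. q \<in> U \<Longrightarrow> c q \<in> ball z r \<Longrightarrow> X v q = cvec U c q v"
    and cvec_y: "\<And>q v e. q \<in> U \<Longrightarrow> c q \<in> ball z r \<Longrightarrow> cvec U c q v (y e) = v \<bullet> e"
    and q: "q0 \<in> U" "q1 \<in> U" "c q0 \<in> ball z r" "c q1 \<in> ball z r"
  shows "dim {x. cvec U c q0 x \<in> eigenspace A (endo_comp h h) q0 \<mu>} \<le>
    dim {x. cvec U c q1 x \<in> eigenspace A (endo_comp h h) q1 \<mu>}"
proof -
  define v where "v = c q1 - c q0"
  define x where "x t = c q0 + t *\<^sub>R v" for t
  define \<gamma> where "\<gamma> t = inv_into U c (x t)" for t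
  have x_ball: "x t \<in> ball z r" if "t \<in> {0..1}" for t
  proof -
    have "x t = (1 - t) *\<^sub>R c q0 + t *\<^sub>R c q1" by (simp add: x_def v_def algebra_simps)
    then show ?thesis
      using convexD[OF convex_ball q(3,4), of "1 - t" t] that by simp
  qed
  have xU: "x t \<in> c ` U" if "t \<in> {0..1}" for t using x_ball[OF that] sub by blast
  have \<gamma>: "\<gamma> t \<in> U" "c (\<gamma> t) = x t" "c (\<gamma> t) \<in> ball z r" if "t \<in> {0..1}" for t
    using inv_into_into[OF xU[OF that]] f_inv_into_f[OF xU[OF that]] x_ball[OF that] by (simp_all add: \<gamma>_def)
  have \<gamma>01: "\<gamma> 0 = q0" "\<gamma> 1 = q1" using q Uc by (simp_all add: \<gamma>_def x_def v_def)
  define L where "L t = cvec U c (\<gamma> t)" for t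
  have L: "linear (L t)" and L_range: "TS (\<gamma> t) = range (L t)" if "t \<in> {0..1}" for t
    using cvec_linear[OF Uc \<gamma>(1)[OF that]] tangent_space_eq_range[OF Uc \<gamma>(1)[OF that]] by (simp_all add: L_def)
  have L_TS: "L t a \<in> TS (\<gamma> t)" if "t \<in> {0..1}" for t a using L_range[OF that] by simp
  have L_y: "L t a (y e) = a \<bullet> e" if "t \<in> {0..1}" for t a e
    unfolding L_def by (rule cvec_y[OF \<gamma>(1,3)[OF that]])
  have X_L: "X a (\<gamma> t) = L t a" if "t \<in> {0..1}" for t a
    unfolding L_def by (rule X_eq[OF \<gamma>(1,3)[OF that]])
  let ?V = "X v"
  have curve: "((\<lambda>t. f (\<gamma> t)) has_real_derivative act ?V f (\<gamma> t)) (at t within {0..1})"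
    if f: "f \<in> SF" and t: "t \<in> {0..1}" for f t
    using chart_line_has_derivative[OF Uc(1) xU[OF t, unfolded x_def] f] X_L[OF t, of v]
    by (simp add: \<gamma>_def x_def act_def L_def has_field_derivative_at_within)
  have SF_cont: "continuous_on {0..1} (\<lambda>t. f (\<gamma> t))" if "f \<in> SF" for f
    by (rule DERIV_continuous_on[OF curve[OF that]])
  \<comment> \<open>Components of \<open>D\<^sub>V X\<^sub>b\<close> along the segment; reading them
    off with the functions \<open>y e\<close> makes their continuity in \<open>t\<close>
    evident.\<close>
  define w where "w b t = (\<Sum>e\<in>Basis. act (D ?V (X b)) (y e) (\<gamma> t) *\<^sub>R e)" for b t
  have w: "L t (w b t) = D ?V (X b) (\<gamma> t)" if t: "t \<in> {0..1}" for b t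
  proof -
    obtain u where u: "D ?V (X b) (\<gamma> t) = L t u"
      using VF_tangent[OF D_VF[OF X X]] L_range[OF t] by blast
    have "w b t = u"
      by (simp add: w_def act_def u L_y[OF t] euclidean_representation)
    then show ?thesis by (simp add: u)
  qed
  \<comment> \<open>Parallel transport of a section with coefficient vector \<open>a\<close> is the
    equation \<open>a' = W t a\<close>.\<close>
  define W where "W t a = - (\<Sum>b\<in>Basis. (a \<bullet> b) *\<^sub>R w b t)" for t a
  have W_linear: "linear (W t)" for t
    unfolding W_def by (rule linearI) (simp_all add: inner_add_left scaleR_left_distrib sum.distrib scaleR_right.sum)
  have W_cont: "continuous_on {0..1} (\<lambda>t. W t a)" for a
    unfolding W_def w_def by (intro continuous_intros SF_cont VF_act D_VF X y)
  obtain \<Phi> where \<Phi>: "\<And>t. linear (\<Phi> t)" "\<And>a. \<Phi> 0 a = a"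
    "\<And>a t. t \<in> {0..1} \<Longrightarrow> ((\<lambda>t. \<Phi> t a) has_vector_derivative W t (\<Phi> t a)) (at t within {0..1})"
    using linear_ode_flow[of W, OF W_linear W_cont] by metis
  \<comment> \<open>Used twice: with the identity, so that transport is isometric and hence
    injective, and with \<open>h\<^sup>2 - \<mu>\<close>, whose kernel is thereby preserved.\<close>
  have norm_const: "g q1 (K q1 (L 1 (\<Phi> 1 a))) (K q1 (L 1 (\<Phi> 1 a))) = g q0 (K q0 (L 0 a)) (K q0 (L 0 a))"
    if K_VF: "\<And>Z. Z \<in> VF \<Longrightarrow> app K Z \<in> VF" and K_lin: "\<And>p. linear_on_set (TS p) (K p)"
      and K_D: "\<And>Y Z. Y \<in> VF \<Longrightarrow> Z \<in> VF \<Longrightarrow> D Y (app K Z) = app K (D Y Z)"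
    for K a
  proof -
    have K_sum: "K (\<gamma> t) (L t (\<Sum>b\<in>Basis. k b *\<^sub>R u b)) = (\<Sum>b\<in>Basis. k b *\<^sub>R K (\<gamma> t) (L t (u b)))"
      if t: "t \<in> {0..1}" for t k and u :: "'e \<Rightarrow> 'e"
    proof -
      have lin: "linear (\<lambda>a. K (\<gamma> t) (L t a))"
        by (rule linearI) (simp_all only: linear_add[OF L[OF t]] linear_scale[OF L[OF t]]
            linear_on_set_rules(1,2)[OF K_lin] L_TS[OF t])
      show ?thesis
        using linear_sum[OF lin, of "\<lambda>b. k b *\<^sub>R u b" Basis] unfolding linear_scale[OF lin] .
    qed
    have XK: "app K (X b) (\<gamma> t) = K (\<gamma> t) (L t b)" if "t \<in> {0..1}" for b t
      by (simp only: app_def X_L[OF that])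
    have repr: "K (\<gamma> t) (L t u) = (\<Sum>b\<in>Basis. (u \<bullet> b) *\<^sub>R app K (X b) (\<gamma> t))" if t: "t \<in> {0..1}" for t u
      using K_sum[OF t, of "\<lambda>b. u \<bullet> b" "\<lambda>b. b"] by (simp only: XK[OF t] euclidean_representation)
    have "g (\<gamma> 1) (\<Sum>b\<in>Basis. (\<Phi> 1 a \<bullet> b) *\<^sub>R app K (X b) (\<gamma> 1)) (\<Sum>b\<in>Basis. (\<Phi> 1 a \<bullet> b) *\<^sub>R app K (X b) (\<gamma> 1)) =
      g (\<gamma> 0) (\<Sum>b\<in>Basis. (\<Phi> 0 a \<bullet> b) *\<^sub>R app K (X b) (\<gamma> 0)) (\<Sum>b\<in>Basis. (\<Phi> 0 a \<bullet> b) *\<^sub>R app K (X b) (\<gamma> 0))"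
    proof (rule parallel_section_norm[where V = ?V and a' = "\<lambda>b t. W t (\<Phi> t a) \<bullet> b"])
      fix t :: real assume t: "t \<in> {0..1}"
      show "((\<lambda>t. \<Phi> t a \<bullet> b) has_real_derivative W t (\<Phi> t a) \<bullet> b) (at t within {0..1})" for b
        unfolding has_real_derivative_iff_has_vector_derivative
        using bounded_linear.has_vector_derivative[OF bounded_linear_inner_left \<Phi>(3)[OF t]] .
      have "(\<Sum>b\<in>Basis. (\<Phi> t a \<bullet> b) *\<^sub>R D ?V (app K (X b)) (\<gamma> t)) =
          (\<Sum>b\<in>Basis. (\<Phi> t a \<bullet> b) *\<^sub>R K (\<gamma> t) (L t (w b t)))"
        by (simp only: K_D[OF X X] w[OF t]) (simp only: app_def)
      also have "\<dots> = K (\<gamma> t) (L t (- W t (\<Phi> t a)))"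
        by (simp only: K_sum[OF t, symmetric] W_def minus_minus)
      also have "\<dots> = - K (\<gamma> t) (L t (W t (\<Phi> t a)))"
        by (simp only: linear_neg[OF L[OF t]] linear_on_set_rules(3)[OF K_lin L_TS[OF t]])
      also have "K (\<gamma> t) (L t (W t (\<Phi> t a))) = (\<Sum>b\<in>Basis. (W t (\<Phi> t a) \<bullet> b) *\<^sub>R app K (X b) (\<gamma> t))"
        by (rule repr[OF t])
      finally show "(\<Sum>b\<in>Basis. (W t (\<Phi> t a) \<bullet> b) *\<^sub>R app K (X b) (\<gamma> t)) +
          (\<Sum>b\<in>Basis. (\<Phi> t a \<bullet> b) *\<^sub>R D ?V (app K (X b)) (\<gamma> t)) = 0"
        by (simp only: add.right_inverse)
    qed (intro X K_VF curve | assumption)+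
    then show ?thesis
      using repr[of 0 "\<Phi> 0 a"] repr[of 1 "\<Phi> 1 a"] by (simp only: \<gamma>01 \<Phi>(2)) simp
  qed
  have isometry: "g q1 (L 1 (\<Phi> 1 a)) (L 1 (\<Phi> 1 a)) = g q0 (L 0 a) (L 0 a)" for a
    using norm_const[of "\<lambda>p t. t" a] by (simp add: app_def linear_on_set_def)
  define K where "K p t = h p (h p t) - \<mu> *\<^sub>R t" for p t
  have K_app: "app K Z = H (H Z) - fmult (\<lambda>p. \<mu>) Z" for Z
    by (simp add: app_def K_def fmult_def fun_eq_iff)
  have K_TS: "t \<in> TS p \<Longrightarrow> K p t \<in> TS p" for p t
    by (simp add: K_def)
  have K_norm: "g q1 (K q1 (L 1 (\<Phi> 1 a))) (K q1 (L 1 (\<Phi> 1 a))) = g q0 (K q0 (L 0 a)) (K q0 (L 0 a))" for a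
  proof (rule norm_const)
    show "app K Z \<in> VF" if "Z \<in> VF" for Z using that by (simp add: K_app)
    show "D Y (app K Z) = app K (D Y Z)" if "Y \<in> VF" "Z \<in> VF" for Y Z
      unfolding K_app using that by (simp add: D_linear D_HH)
    show "linear_on_set (TS p) (K p)" for p
      unfolding linear_on_set_def K_def by (auto simp: h_rules scaleR_diff_right; simp add: fun_eq_iff scaleR_fun_def algebra_simps)
  qed
  have eig: "L t a \<in> eigenspace A (endo_comp h h) (\<gamma> t) \<mu> \<longleftrightarrow> g (\<gamma> t) (K (\<gamma> t) (L t a)) (K (\<gamma> t) (L t a)) = 0"
    if t: "t \<in> {0..1}" for t a
  proof -
    have "g (\<gamma> t) (K (\<gamma> t) (L t a)) (K (\<gamma> t) (L t a)) = 0 \<longleftrightarrow> K (\<gamma> t) (L t a) = 0"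
      using g_pos[OF K_TS[OF L_TS[OF t]], of a] g_rules(5)[of 0 "\<gamma> t"] by force
    then show ?thesis
      using L_TS[OF t, of a] by (simp add: eigenspace_def endo_comp_def K_def)
  qed
  let ?S = "\<lambda>t. {a. L t a \<in> eigenspace A (endo_comp h h) (\<gamma> t) \<mu>}"
  have "\<Phi> 1 ` ?S 0 \<subseteq> ?S 1"
    using eig[of 0] eig[of 1] K_norm \<gamma>01 by auto
  then have "dim (\<Phi> 1 ` ?S 0) \<le> dim (?S 1)" by (rule dim_subset)
  moreover have "inj (\<Phi> 1)"
    unfolding linear_injective_0[OF \<Phi>(1)]
  proof safe
    fix a assume "\<Phi> 1 a = 0"
    then have "g q0 (L 0 a) (L 0 a) = 0"
      using isometry[of a] linear_0[OF L[of 1]] g_rules(5)[of 0 q1] by simp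
    then have "L 0 a = 0"
      using g_pos[OF L_TS[of 0 a]] \<gamma>01 by force
    then have "a \<bullet> e = 0" for e using L_y[of 0 a e] by simp
    then show "a = 0" using inner_eq_zero_iff by blast
  qed
  then have "dim (\<Phi> 1 ` ?S 0) = dim (?S 0)"
    by (intro dim_image_eq \<Phi>(1)) (auto intro: inj_on_subset)
  ultimately show ?thesis by (simp add: L_def \<gamma>01)
qed

text \<open>In a chart the eigenspaces become subspaces of the model space, where
  \<open>dim_eigenspace_le\<close> applies in both directions; connectedness spreads the local
  constancy.\<close>

lemma dim_eigenspace_constant:
  assumes conn: "connected (UNIV :: 'a set)"
  shows "dim (eigenspace A (endo_comp h h) p \<mu>) = dim (eigenspace A (endo_comp h h) q \<mu>)"
proof -
  let ?d = "\<lambda>p. dim (eigenspace A (endo_comp h h) p \<mu>)"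
  have "\<forall>\<^sub>F q in at p within UNIV. ?d p = ?d q" for p
  proof -
    obtain U c r and X :: "'e \<Rightarrow> 'a vfield" and y :: "'e \<Rightarrow> 'a \<Rightarrow> real"
      where Uc: "(U, c) \<in> A" "p \<in> U" and r: "r > 0" "ball (c p) r \<subseteq> c ` U"
        and X: "\<And>v. X v \<in> VF" and y: "\<And>e. y e \<in> SF"
        and X_eq: "\<And>q v. q \<in> U \<Longrightarrow> c q \<in> ball (c p) r \<Longrightarrow> X v q = cvec U c q v"
        and cvec_y: "\<And>q v e. q \<in> U \<Longrightarrow> c q \<in> ball (c p) r \<Longrightarrow> cvec U c q v (y e) = v \<bullet> e"
      using local_frame by metis
    let ?S = "\<lambda>q. {x. cvec U c q x \<in> eigenspace A (endo_comp h h) q \<mu>}"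
    have dim_S: "?d q = dim (?S q)" if q: "q \<in> U" "c q \<in> ball (c p) r" for q
    proof -
      have "eigenspace A (endo_comp h h) q \<mu> = cvec U c q ` ?S q"
        using tangent_space_eq_range[OF Uc(1) q(1)] by (auto simp: eigenspace_def)
      moreover have "inj (cvec U c q)"
      proof (rule injI)
        fix v w assume "cvec U c q v = cvec U c q w"
        then have *: "v \<bullet> e = w \<bullet> e" for e
          using cvec_y[OF q, of v e] cvec_y[OF q, of w e] by simp
        show "v = w" by (rule euclidean_eqI) (rule *)
      qed
      ultimately show ?thesis
        using dim_image_eq[OF cvec_linear[OF Uc(1) q(1)], of "?S q"] by (simp add: inj_on_subset)
    qed
    have eq: "?d p = ?d q" if q: "q \<in> U" "c q \<in> ball (c p) r" for q
    proof -
      have p: "c p \<in> ball (c p) r" using r by simp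
      show ?thesis
        unfolding dim_S[OF q] dim_S[OF Uc(2) p]
        by (intro antisym dim_eigenspace_le[OF Uc(1) r(2) X y X_eq cvec_y] q p Uc(2))
    qed
    have "open (c -` ball (c p) r \<inter> U)"
      using continuous_on_open_vimage[OF chart_open[OF Uc(1)]] chart_continuous[OF Uc(1)] by blast
    moreover have "p \<in> c -` ball (c p) r \<inter> U" using Uc(2) r(1) by simp
    ultimately show ?thesis
      unfolding eventually_at_topological using eq by (intro exI[of _ "c -` ball (c p) r \<inter> U"]) auto
  qed
  then show ?thesis
    by (intro connected_local_const[OF conn]) auto
qed

lemma eigenvalues_eq_dim: "eigenvalues A (endo_comp h h) p = {\<mu>. dim (eigenspace A (endo_comp h h) p \<mu>) \<noteq> 0}"
proof -
  obtain U c where Uc: "(U, c) \<in> A" "p \<in> U" by (rule chart_cover)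
  let ?E = "\<lambda>\<mu>. eigenspace A (endo_comp h h) p \<mu>"
  have *: "?E \<mu> \<subseteq> {0} \<longleftrightarrow> dim (?E \<mu>) = 0" for \<mu>
  proof
    assume "dim (?E \<mu>) = 0"
    obtain B where B: "B \<subseteq> ?E \<mu>" "independent B" "?E \<mu> \<subseteq> span B" "card B = dim (?E \<mu>)"
      by (rule basis_exists)
    \<comment> \<open>An infinite \<open>B\<close> would also have \<open>card B = 0\<close>, so
      finiteness has to be secured first; it holds because \<open>TS p\<close> is spanned by the
      image of the standard basis.\<close>
    have "finite B"
    proof -
      have "TS p = span (cvec U c p ` Basis)"
        using tangent_space_eq_range[OF Uc] linear_span_image[OF cvec_linear[OF Uc], of Basis] by simp
      then have "B \<subseteq> span (cvec U c p ` Basis)"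
        using B(1) by (auto simp: eigenspace_def)
      from independent_span_bound[OF finite_imageI[OF finite_Basis] B(2) this]
      show ?thesis ..
    qed
    then show "?E \<mu> \<subseteq> {0}"
      using B \<open>dim (?E \<mu>) = 0\<close> by auto
  next
    assume "?E \<mu> \<subseteq> {0}"
    then have "span {} = span (?E \<mu>)"
      by (metis span_empty span_insert_0 subset_singletonD)
    then show "dim (?E \<mu>) = 0"
      using dim_eq_card[of "{}" "?E \<mu>"] by (simp add: independent_empty)
  qed
  have "(\<exists>v\<in>?E \<mu>. v \<noteq> 0) \<longleftrightarrow> dim (?E \<mu>) \<noteq> 0" for \<mu>
    unfolding *[symmetric] by blast
  then show ?thesis by (simp add: eigenvalues_def)
qed

end

theorem proposition3p2:
  fixes A :: "('a::{t2_space,second_countable_topology}, 'e::euclidean_space) chart set"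
    and nabla :: "'a vfield \<Rightarrow> 'a vfield \<Rightarrow> 'a vfield"
    and \<phi> h :: "'a endo_field"
    and \<xi> :: "'a vfield"
    and \<eta> :: "'a \<Rightarrow> 'a tangent \<Rightarrow> real"
    and g :: "'a \<Rightarrow> 'a tangent \<Rightarrow> 'a tangent \<Rightarrow> real"
    and n :: nat
  assumes "smooth_atlas A"
    and "connected (UNIV :: 'a set)"
    and "DIM('e) = 2 * n + 1"
    and "nearly_sasakian A nabla \<phi> \<xi> \<eta> g"
    and "tensor_field_11 A h"
    and "\<forall>X\<in>vector_fields A. nabla X \<xi> = - app \<phi> X + app h X"
  shows "\<forall>p q. eigenvalues A (endo_comp h h) p = eigenvalues A (endo_comp h h) q \<and>
           (\<forall>\<mu>. dim (eigenspace A (endo_comp h h) p \<mu>) = dim (eigenspace A (endo_comp h h) q \<mu>))"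
proof -
  interpret nearly_sasakian_manifold A nabla \<phi> h \<xi> \<eta> g
    by unfold_locales (fact assms)+
  show ?thesis
  proof (intro allI conjI)
    fix p q \<mu>
    show dim: "dim (eigenspace A (endo_comp h h) p \<mu>) = dim (eigenspace A (endo_comp h h) q \<mu>)" for \<mu>
      by (rule dim_eigenspace_constant[OF assms(2)])
    show "eigenvalues A (endo_comp h h) p = eigenvalues A (endo_comp h h) q"
      unfolding eigenvalues_eq_dim dim ..
  qed
qed

end
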